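(* Let $R=\langle s,r_1,r_2,\ldots\rangle$ be a sequence of nonnegative integers with $s\ge1$ which is eventually constant, i.e. there is an integer $k\ge 1$ with $r_i=r_{k+1}$ for all $i\ge k+1$, and let $a=a_R$ be the associated function as in the context. Then the limit $\lim_{n\to\infty}a(n)/n$ exists if and only if at least one of the following holds: (1) $\sum_{i\ge1}r_i\in\{0,1\}$; (2) $\gcd\{i\ge 1: r_i\ge 1\}=1$. Moreover, if the limit exists, it equals the smallest positive root of the polynomial $$(1-x)\left(r_0+r_1x+\cdots+r_kx^k\right)+r_{k+1}x^{k+1},$$ where $r_0=-1$.
   Context: For a sequence $R=\langle s,r_1,r_2,\ldots\rangle$ of nonnegative integers with $s\ge 1$: let $\Sigma=\{\mathtt r,\mathtt 0,\mathtt 1,\mathtt 2,\ldots\}$ be the infinite alphabet consisting of a letter $\mathtt r$ together with a letter $[j]$ for each integer $j\ge 0$; for a letter $\mathtt x$ and $m\ge0$, $\mathtt x^m$ is the word of $m$ copies of $\mathtt x$; let $\sigma$ be the morphism of words over $\Sigma$ defined by $\sigma(\mathtt r)=\mathtt r\,\mathtt 0^{s}$ and $\sigma([j])=[j+1]\,\mathtt 0^{r_{j+1}}$ for $j\ge 0$. Let $\mathcal T$ be the infinite rooted ordered tree whose root is labelled $\mathtt r$ and in which the labels of the children of any node labelled $\mathtt x$, read left to right, spell $\sigma(\mathtt x)$. For a node $v$, $\ell(v)$ is the number of nodes in the same row (depth) as $v$ lying strictly to its left. Define $a_R:\mathbb Z\to\mathbb Z_{\ge0}$ by $a_R(n)=0$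 for $n<0$ and $a_R(\ell(v))=\ell(\mathrm{parent}(v))$ for every non-root node $v$ of $\mathcal T$ (this is well defined). *)

theory Defs
  imports Complex_Main "HOL-Computational_Algebra.Polynomial"
begin

text \<open>
  A sequence \<open>\<langle>s, r\<^sub>1, r\<^sub>2, \<dots>\<rangle>\<close> is given by \<open>s :: nat\<close> and \<open>r :: nat \<Rightarrow> nat\<close>, where
  the value \<open>r 0\<close> is never used.
\<close>

datatype letter = Rt | Digit nat

text \<open>The images of the letters, which determine the morphism on words.\<close>

fun sigma :: "nat \<Rightarrow> (nat \<Rightarrow> nat) \<Rightarrow> letter \<Rightarrow> letter list" where
  "sigma s r Rt = Rt # replicate s (Digit 0)"
| "sigma s r (Digit j) = Digit (Suc j) # replicate (r (Suc j)) (Digit 0)"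

text \<open>
  A node is represented by its address, the list of child indices (counted from the left,
  starting with 0) on the path from the root. So \<^term>\<open>[]\<close> is the root, the depth of a node is
  the length of its address, and the parent of a non-root node \<open>v\<close> is \<^term>\<open>butlast v\<close>.
\<close>

inductive labelled_node :: "nat \<Rightarrow> (nat \<Rightarrow> nat) \<Rightarrow> nat list \<Rightarrow> letter \<Rightarrow> bool"
  for s :: nat and r :: "nat \<Rightarrow> nat" where
  root: "labelled_node s r [] Rt"
| child: "labelled_node s r v x \<Longrightarrow> i < length (sigma s r x) \<Longrightarrow>
    labelled_node s r (v @ [i]) (sigma s r x ! i)"

definition nodes :: "nat \<Rightarrow> (nat \<Rightarrow> nat) \<Rightarrow> nat list set" where
  "nodes s r = {v. \<exists>x. labelled_node s r v x}"

text \<open>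
  Two nodes of the same row are ordered from left to right by the lexicographic order of their
  addresses; \<^const>\<open>lex\<close> relates only lists of equal length.
\<close>

definition left_count :: "nat \<Rightarrow> (nat \<Rightarrow> nat) \<Rightarrow> nat list \<Rightarrow> nat" where
  "left_count s r v = card {w \<in> nodes s r. (w, v) \<in> lex less_than}"

text \<open>The description is proper for \<open>s \<ge> 1\<close>; see \<open>a_R_unique\<close> below.\<close>

definition a_R :: "nat \<Rightarrow> (nat \<Rightarrow> nat) \<Rightarrow> int \<Rightarrow> nat" where
  "a_R s r n = (if n < 0 then 0 else
     (THE m. \<exists>v \<in> nodes s r. v \<noteq> [] \<and> int (left_count s r v) = n
                              \<and> m = left_count s r (butlast v)))"

text \<open>By convention \<open>r\<^sub>0 = -1\<close> in the following polynomial, whatever the value \<open>r 0\<close> is.\<close>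

definition limit_poly :: "(nat \<Rightarrow> nat) \<Rightarrow> nat \<Rightarrow> real poly" where
  "limit_poly r k =
     [:1, -1:] * (\<Sum>i\<le>k. monom (if i = 0 then -1 else real (r i)) i)
       + monom (real (r (k + 1))) (k + 1)"

definition smallest_positive_root :: "real poly \<Rightarrow> real \<Rightarrow> bool" where
  "smallest_positive_root p x \<longleftrightarrow>
     x > 0 \<and> poly p x = 0 \<and> (\<forall>y. y > 0 \<and> poly p y = 0 \<longrightarrow> x \<le> y)"

subsection \<open>Well-definedness of \<open>a_R\<close>\<close>

lemma Nil_in_nodes: "[] \<in> nodes s r"
  by (auto simp: nodes_def intro: labelled_node.root)

lemma labelled_node_Cons_0:
  "labelled_node s r (0 # v) x \<longleftrightarrow> labelled_node s r v x"
proof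
  show "labelled_node s r (0 # v) x" if "labelled_node s r v x"
    using that
  proof (induction rule: labelled_node.induct)
    case root
    show ?case
      using labelled_node.child[OF labelled_node.root, of 0 s r] by simp
  next
    case (child v x i)
    then show ?case
      using labelled_node.child[of s r "0 # v" x i] by simp
  qed
  have "labelled_node s r u x \<Longrightarrow> u = 0 # v \<Longrightarrow> labelled_node s r v x" for u
  proof (induction arbitrary: v rule: labelled_node.induct)
    case root
    then show ?case by simp
  next
    case (child u x i)
    show ?case
    proof (cases u)
      case Nil
      with child.hyps have "x = Rt"
        by (auto elim: labelled_node.cases)
      with Nil child.prems show ?thesis
        by (simp add: labelled_node.root)
    next
      case (Cons j u')
      with child.prems have "j = 0" "v = u' @ [i]" by auto
      with child Cons show ?thesis
        by (auto intro: labelled_node.child)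
    qed
  qed
  then show "labelled_node s r v x" if "labelled_node s r (0 # v) x"
    using that by blast
qed

lemma Cons_0_in_nodes: "0 # v \<in> nodes s r \<longleftrightarrow> v \<in> nodes s r"
  unfolding nodes_def using labelled_node_Cons_0[of s r v] by blast

lemma left_count_Cons_0: "left_count s r (0 # v) = left_count s r v"
proof -
  have "{w \<in> nodes s r. (w, 0 # v) \<in> lex less_than} =
        (#) 0 ` {w \<in> nodes s r. (w, v) \<in> lex less_than}" (is "?A = ?B")
  proof
    show "?A \<subseteq> ?B"
    proof
      fix w assume w: "w \<in> ?A"
      then obtain j w' where "w = j # w'" by (cases w) auto
      with w show "w \<in> ?B" by (auto simp: Cons_0_in_nodes)
    qed
    show "?B \<subseteq> ?A" by (auto simp: Cons_0_in_nodes)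
  qed
  then show ?thesis
    by (simp add: left_count_def card_image)
qed

lemma replicate_0_append:
  "replicate m 0 @ v \<in> nodes s r \<longleftrightarrow> v \<in> nodes s r"
  "left_count s r (replicate m 0 @ v) = left_count s r v"
  by (induction m) (simp_all add: Cons_0_in_nodes left_count_Cons_0)

lemma finite_row: "finite {v \<in> nodes s r. length v = d}"
proof (induction d)
  case 0
  have "{v \<in> nodes s r. length v = 0} \<subseteq> {[]}" by auto
  then show ?case by (rule finite_subset) simp
next
  case (Suc d)
  have fun_label: "labelled_node s r v x \<Longrightarrow> labelled_node s r v y \<Longrightarrow> x = y" for v x y
  proof (induction arbitrary: y rule: labelled_node.induct)
    case root
    then show ?case by (auto elim: labelled_node.cases)
  next
    case (child v x i)
    from child.prems obtain z where "labelled_node s r v z" "y = sigma s r z ! i"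
      by (cases rule: labelled_node.cases) auto
    with child.IH show ?case by auto
  qed
  let ?lab = "\<lambda>v. THE x. labelled_node s r v x"
  have "{v \<in> nodes s r. length v = Suc d} \<subseteq>
     (\<Union>v\<in>{v \<in> nodes s r. length v = d}. (\<lambda>i. v @ [i]) ` {..<length (sigma s r (?lab v))})"
  proof
    fix u assume "u \<in> {v \<in> nodes s r. length v = Suc d}"
    then obtain y where "labelled_node s r u y" and l: "length u = Suc d"
      by (auto simp: nodes_def)
    then obtain v x i where u: "u = v @ [i]" "labelled_node s r v x" "i < length (sigma s r x)"
      by (auto elim: labelled_node.cases)
    moreover from u(2) fun_label have "?lab v = x" by blast
    ultimately show "u \<in> (\<Union>v\<in>{v \<in> nodes s r. length v = d}.
        (\<lambda>i. v @ [i]) ` {..<length (sigma s r (?lab v))})"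
      using l by (auto simp: nodes_def)
  qed
  then show ?case
    using Suc by (auto intro: finite_subset)
qed

lemma left_count_row:
  assumes "v \<in> nodes s r"
  shows "left_count s r v = card {w \<in> {w \<in> nodes s r. length w = length v}. (w, v) \<in> lex less_than}"
proof -
  have "(w, v) \<in> lex less_than \<Longrightarrow> length w = length v" for w
    by (auto simp: lex_conv)
  then show ?thesis
    unfolding left_count_def by (auto intro: arg_cong[where f = card])
qed

lemma lex_nat_total:
  "length v = length w \<Longrightarrow> v \<noteq> w \<Longrightarrow> (v, w) \<in> lex less_than \<or> (w, v) \<in> lex less_than"
  for v w :: "nat list"
  by (induction v w rule: list_induct2) auto

lemma left_count_strict:
  assumes "v \<in> nodes s r" "w \<in> nodes s r" "(v, w) \<in> lex less_than"
  shows "left_count s r v < left_count s r w"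
proof -
  have l: "length v = length w" using assms(3) by (auto simp: lex_conv)
  have tr: "trans (lex less_than)" by (rule lex_transI) simp
  have irr: "(v, v) \<notin> lex less_than" by (auto simp: lex_conv)
  have "{u \<in> {u \<in> nodes s r. length u = length v}. (u, v) \<in> lex less_than} \<subset>
        {u \<in> {u \<in> nodes s r. length u = length w}. (u, w) \<in> lex less_than}"
    using assms tr irr l by (auto dest: transD)
  moreover have "finite {u \<in> {u \<in> nodes s r. length u = length w}. (u, w) \<in> lex less_than}"
    by (rule finite_subset[OF _ finite_row[of s r "length w"]]) auto
  ultimately show ?thesis
    using assms by (simp add: left_count_row psubset_card_mono)
qed

lemma left_count_inj:
  assumes "v \<in> nodes s r" "w \<in> nodes s r" "length v = length w"
    and "left_count s r v = left_count s r w"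
  shows "v = w"
  using assms left_count_strict[of v s r w] left_count_strict[of w s r v] lex_nat_total[of v w]
  by fastforce

lemma parent_count_unique:
  assumes "v \<in> nodes s r" "w \<in> nodes s r" "v \<noteq> []" "w \<noteq> []"
    and "left_count s r v = left_count s r w"
  shows "left_count s r (butlast v) = left_count s r (butlast w)"
proof -
  have *: "left_count s r (butlast v) = left_count s r (butlast w)"
    if "v \<in> nodes s r" "w \<in> nodes s r" "v \<noteq> []" "length v \<le> length w"
      and "left_count s r v = left_count s r w" for v w
  proof -
    have "w = replicate (length w - length v) 0 @ v"
      using that by (intro left_count_inj) (auto simp: replicate_0_append)
    then have "butlast w = replicate (length w - length v) 0 @ butlast v"
      using that(3) by (metis butlast_append)
    then show ?thesis by (simp add: replicate_0_append)
  qed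
  show ?thesis
    using *[of v w] *[of w v] assms by (cases "length v \<le> length w") auto
qed

lemma row_card:
  assumes "s \<ge> 1"
  shows "d + 1 \<le> card {v \<in> nodes s r. length v = d}"
proof -
  define f :: "nat \<Rightarrow> nat list" where "f j = replicate j 0 @ (if j < d then 1 # replicate (d - Suc j) 0 else [])"
    for j :: nat
  have snoc_0: "v @ replicate m 0 \<in> nodes s r" if "v \<in> nodes s r" for v m
  proof (induction m)
    case (Suc m)
    then obtain x where "labelled_node s r (v @ replicate m 0) x" by (auto simp: nodes_def)
    from labelled_node.child[OF this, of 0] show ?case
      by (cases x) (auto simp: nodes_def replicate_append_same)
  qed (use that in simp)
  have "[1] \<in> nodes s r"
    using labelled_node.child[OF labelled_node.root, of 1 s r] assms by (auto simp: nodes_def)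
  from snoc_0[OF this] have in_nodes: "f j \<in> nodes s r" for j
    by (auto simp: f_def replicate_0_append Nil_in_nodes
        replicate_0_append(1)[where v = "[]", simplified])
  have "inj_on f {..d}"
  proof (rule linorder_inj_onI)
    fix i j assume "i < j" "i \<in> {..d}" "j \<in> {..d}"
    then have "f i ! i = 1" "f j ! i = 0"
      by (auto simp: f_def nth_append)
    then show "f i \<noteq> f j" by auto
  qed auto
  moreover have "f ` {..d} \<subseteq> {v \<in> nodes s r. length v = d}"
    using in_nodes by (auto simp: f_def)
  ultimately have "card {..d} \<le> card {v \<in> nodes s r. length v = d}"
    by (metis card_image card_mono finite_row)
  then show ?thesis by simp
qed

lemma left_count_surj:
  assumes "s \<ge> 1"
  shows "\<exists>v \<in> nodes s r. v \<noteq> [] \<and> left_count s r v = n"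
proof -
  let ?V = "{v \<in> nodes s r. length v = Suc n}"
  have "left_count s r ` ?V \<subseteq> {..<card ?V}"
  proof
    fix m assume "m \<in> left_count s r ` ?V"
    then obtain v where v: "v \<in> ?V" and m: "m = left_count s r v" by auto
    have "{w \<in> ?V. (w, v) \<in> lex less_than} \<subset> ?V"
    proof -
      have "(v, v) \<notin> lex less_than" by (auto simp: lex_conv)
      with v show ?thesis by blast
    qed
    then have "card {w \<in> ?V. (w, v) \<in> lex less_than} < card ?V"
      by (rule psubset_card_mono[OF finite_row])
    with v m show "m \<in> {..<card ?V}" by (simp add: left_count_row)
  qed
  moreover have "card (left_count s r ` ?V) = card ?V"
    by (intro card_image inj_onI) (auto intro: left_count_inj)
  ultimately have "left_count s r ` ?V = {..<card ?V}"
    by (intro card_subset_eq) auto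
  moreover have "n < card ?V" using row_card[OF assms, of "Suc n" r] by simp
  ultimately have "n \<in> left_count s r ` ?V" by auto
  then obtain v where "v \<in> ?V" "left_count s r v = n" by blast
  then show ?thesis by (intro bexI[of _ v]) auto
qed

lemma a_R_neg: "n < 0 \<Longrightarrow> a_R s r n = 0"
  by (simp add: a_R_def)

lemma a_R_left_count:
  assumes "v \<in> nodes s r" "v \<noteq> []"
  shows "a_R s r (int (left_count s r v)) = left_count s r (butlast v)"
  unfolding a_R_def using assms by (auto intro!: the_equality dest: parent_count_unique)

lemma a_R_unique:
  assumes "s \<ge> 1" "\<And>n. n < 0 \<Longrightarrow> a n = 0"
    and "\<And>v. v \<in> nodes s r \<Longrightarrow> v \<noteq> [] \<Longrightarrow> a (int (left_count s r v)) = left_count s r (butlast v)"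
  shows "a = a_R s r"
proof
  fix n :: int
  show "a n = a_R s r n"
  proof (cases "n < 0")
    case False
    then obtain v where "v \<in> nodes s r" "v \<noteq> []" "n = int (left_count s r v)"
      using left_count_surj[OF assms(1), of r "nat n"] by auto
    then show ?thesis using assms(3) by (simp add: a_R_left_count)
  qed (simp add: assms(2) a_R_neg)
qed

end

theory Submission
  imports "HOL-Library.Sublist" "HOL-Complex_Analysis.Complex_Analysis" Defs
begin

text \<open>
  Let \<open>c\<^sub>n\<close> be the length of \<open>\<sigma>\<^sup>n(0)\<close>, so that \<open>c\<^sub>n = 1 + \<Sum>\<^sub>i r\<^sub>i c\<^sub>n\<^sub>-\<^sub>i\<close>. If \<open>p\<close> is the prefix of length
  \<open>n\<close> of the infinite word \<open>\<sigma>\<^sup>\<infinity>(r)\<close>, then \<open>a\<close> takes the value \<open>n\<close> exactly on the positions from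
  \<open>|\<sigma>(p)|\<close> up to the corresponding position of the next prefix, so \<open>a(n)/n\<close> tends to \<open>x\<close> if
  \<open>|p| - x |\<sigma>(p)|\<close> is \<open>o(|p|)\<close>. Every prefix \<open>p\<close> splits into few blocks \<open>\<sigma>\<^sup>i(0)\<close> and single letters,
  which reduces this to \<open>c\<^sub>n - x c\<^sub>n\<^sub>+\<^sub>1 = o(c\<^sub>n)\<close>.

  If \<open>\<Sum>r\<^sub>i \<ge> 2\<close>, the generating function of \<open>c\<close> is \<open>-1/P\<close> where \<open>P\<close> is the polynomial of the theorem,
  and \<open>P(z) = (1 - z) (\<Sum>r\<^sub>i z\<^sup>i - 1)\<close> on the open unit disc. When the gcd is 1, the root \<open>x < 1\<close> of \<open>P\<close> is
  simple and the only root in the disc \<open>|z| \<le> x\<close>, whence \<open>c\<^sub>n x\<^sup>n\<close> tends to a positive constant.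
  When the gcd is \<open>g > 1\<close>, \<open>c\<close> is constant on blocks of \<open>g\<close> indices. Since \<open>a\<close> maps the length of
  each row to that of the preceding row, a limit would have to be 1, contradicting the
  exponential growth of the rows.
\<close>

subsection \<open>Rows of the tree\<close>

definition sigma_word :: "nat \<Rightarrow> (nat \<Rightarrow> nat) \<Rightarrow> letter list \<Rightarrow> letter list" where
  "sigma_word s r w = concat (map (sigma s r) w)"

lemma sigma_word_simps [simp]:
  "sigma_word s r [] = []"
  "sigma_word s r (x # w) = sigma s r x @ sigma_word s r w"
  "sigma_word s r (v @ w) = sigma_word s r v @ sigma_word s r w"
  by (simp_all add: sigma_word_def)

definition row_word :: "nat \<Rightarrow> (nat \<Rightarrow> nat) \<Rightarrow> nat \<Rightarrow> letter list" where
  "row_word s r d = (sigma_word s r ^^ d) [Rt]"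

definition children :: "nat \<Rightarrow> (nat \<Rightarrow> nat) \<Rightarrow> nat list \<times> letter \<Rightarrow> (nat list \<times> letter) list" where
  "children s r = (\<lambda>(v, x). map (\<lambda>i. (v @ [i], sigma s r x ! i)) [0..<length (sigma s r x)])"

text \<open>Addresses and labels are kept together: the first components are the nodes that
  \<open>left_count\<close> counts, the second components spell \<open>row_word\<close>.\<close>

primrec row :: "nat \<Rightarrow> (nat \<Rightarrow> nat) \<Rightarrow> nat \<Rightarrow> (nat list \<times> letter) list" where
  "row s r 0 = [([], Rt)]"
| "row s r (Suc d) = concat (map (children s r) (row s r d))"

lemma map_snd_children: "map snd (children s r p) = sigma s r (snd p)"
  by (cases p) (simp add: children_def comp_def map_nth)

lemma map_snd_concat_children:
  "map snd (concat (map (children s r) ps)) = sigma_word s r (map snd ps)"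
  by (induction ps) (simp_all add: map_snd_children)

lemma map_snd_row: "map snd (row s r d) = row_word s r d"
  by (induction d) (simp_all add: row_word_def map_snd_concat_children del: map_concat)

lemma set_row: "set (row s r d) = {(v, x). labelled_node s r v x \<and> length v = d}"
proof (induction d)
  case 0
  have "x = Rt" if "labelled_node s r [] x" for x
    using that by (cases rule: labelled_node.cases) auto
  then show ?case by (auto intro: labelled_node.root)
next
  case (Suc d)
  show ?case (is "?A = ?B")
  proof
    show "?A \<subseteq> ?B"
      using Suc by (auto simp: children_def intro: labelled_node.child)
    show "?B \<subseteq> ?A"
    proof safe
      fix v x assume "labelled_node s r v x" "length v = Suc d"
      then obtain u y i where "v = u @ [i]" "labelled_node s r u y" "i < length (sigma s r y)"
        "x = sigma s r y ! i" "length u = d"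
        by (cases rule: labelled_node.cases) auto
      then show "(v, x) \<in> set (row s r (Suc d))"
        using Suc by (auto simp: children_def intro!: exI[of _ u] exI[of _ y])
    qed
  qed
qed

definition row_less :: "nat list \<times> letter \<Rightarrow> nat list \<times> letter \<Rightarrow> bool" where
  "row_less p q \<longleftrightarrow> (fst p, fst q) \<in> lex less_than"

lemma sorted_row: "sorted_wrt row_less (row s r d)"
proof (induction d)
  case (Suc d)
  \<comment> \<open>Children of distinct nodes keep the order of their parents, whatever their own
    indices are.\<close>
  have lex_ext: "(v @ [i], w @ [j]) \<in> lex less_than" if "(v, w) \<in> lex less_than" for v w :: "nat list" and i j
  proof -
    from that obtain p x a y b where "v = p @ x # a" "w = p @ y # b" "x < y" "length a = length b"
      by (auto simp: lex_conv)
    then have "v @ [i] = p @ x # (a @ [i])" "w @ [j] = p @ y # (b @ [j])" "length (v @ [i]) = length (w @ [j])"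
      by simp_all
    with \<open>x < y\<close> show ?thesis unfolding lex_conv by blast
  qed
  have inner: "sorted_wrt row_less (children s r p)" for p
    by (cases p) (auto simp: children_def sorted_wrt_map row_less_def lex_append_leftI
        intro: sorted_wrt_mono_rel[OF _ sorted_wrt_upt])
  have "sorted_wrt row_less (concat (map (children s r) ps))" if "sorted_wrt row_less ps" for ps
    using that
  proof (induction ps)
    case (Cons p ps)
    then show ?case
      by (auto simp: sorted_wrt_append inner)
         (force simp: children_def row_less_def intro: lex_ext split: prod.splits)
  qed simp
  then show ?case using Suc by simp
qed simp

text \<open>As the row is sorted, the nodes to the left of the entry at index \<open>n\<close> are
  exactly the \<open>n\<close> entries before it.\<close>

lemma left_count_row_nth:
  assumes "n < length (row s r d)"
  shows "left_count s r (fst (row s r d ! n)) = n"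
proof -
  let ?R = "row s r d"
  have irr: "(v, v) \<notin> lex less_than" for v :: "nat list" by (auto simp: lex_conv)
  have tr: "trans (lex less_than)" by (rule lex_transI) simp
  have lt: "(fst (?R ! i), fst (?R ! j)) \<in> lex less_than" if "i < j" "j < length ?R" for i j
    using sorted_wrt_nth_less[OF sorted_row that] by (simp add: row_less_def)
  have "{w \<in> nodes s r. (w, fst (?R ! n)) \<in> lex less_than} = (\<lambda>i. fst (?R ! i)) ` {..<n}" (is "?A = ?B")
  proof
    show "?B \<subseteq> ?A"
    proof safe
      fix i assume "i < n"
      then have "?R ! i \<in> set ?R" using assms by simp
      then show "fst (?R ! i) \<in> nodes s r"
        unfolding set_row nodes_def by auto
      show "(fst (?R ! i), fst (?R ! n)) \<in> lex less_than" using lt \<open>i < n\<close> assms by blast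
    qed
    show "?A \<subseteq> ?B"
    proof safe
      fix w assume w: "w \<in> nodes s r" "(w, fst (?R ! n)) \<in> lex less_than"
      have "?R ! n \<in> set ?R" using assms by simp
      then have "length (fst (?R ! n)) = d" unfolding set_row by auto
      with w have "length w = d" by (auto simp: lex_conv)
      with w obtain x where "(w, x) \<in> set ?R" unfolding set_row nodes_def by auto
      then obtain i where i: "i < length ?R" "?R ! i = (w, x)" by (auto simp: in_set_conv_nth)
      have "i < n"
        using lt[of n i] irr w i transD[OF tr, of w "fst (?R ! n)" w] by (metis fst_conv linorder_neqE_nat)
      with i show "w \<in> ?B" by (intro image_eqI[of _ _ i]) auto
    qed
  qed
  moreover have "inj_on (\<lambda>i. fst (?R ! i)) {..<n}"
    by (rule linorder_inj_onI) (use lt irr assms in fastforce)+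
  ultimately show ?thesis by (simp add: left_count_def card_image)
qed

text \<open>Carries the tree over to words: to the left of child \<open>i\<close> of
  \<open>u\<close> stand all children of the nodes left of \<open>u\<close>, followed by the
  \<open>i\<close> earlier siblings.\<close>

lemma left_count_child:
  assumes "labelled_node s r u x" "i < length (sigma s r x)" and d: "length u = d"
  defines "n \<equiv> left_count s r u"
  shows "n < length (row_word s r d)" "row_word s r d ! n = x"
    "left_count s r (u @ [i]) = length (sigma_word s r (take n (row_word s r d))) + i"
proof -
  let ?R = "row s r d"
  have "(u, x) \<in> set ?R" using assms by (auto simp: set_row)
  then obtain m where m: "m < length ?R" "?R ! m = (u, x)" by (auto simp: in_set_conv_nth)
  with left_count_row_nth[of m s r d] have nm: "n = m" by (simp add: n_def)
  have len: "length (row_word s r d) = length ?R" by (metis map_snd_row length_map)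
  then show "n < length (row_word s r d)" using m nm by simp
  show "row_word s r d ! n = x" using m nm by (simp flip: map_snd_row)
  let ?P = "concat (map (children s r) (take m ?R))"
  have split: "?R = take m ?R @ (u, x) # drop (Suc m) ?R"
    using m by (metis id_take_nth_drop)
  have row': "row s r (Suc d) = ?P @ children s r (u, x) @ concat (map (children s r) (drop (Suc m) ?R))"
    by (subst row.simps, subst split) simp
  have lenP: "length ?P = length (sigma_word s r (take n (row_word s r d)))"
    by (metis length_map map_snd_concat_children map_snd_row nm take_map)
  have l: "length (children s r (u, x)) = length (sigma s r x)" by (simp add: children_def)
  have "fst (row s r (Suc d) ! (length ?P + i)) = u @ [i]"
    unfolding row' using assms(2) l by (simp add: nth_append children_def)
  moreover have "length ?P + i < length (row s r (Suc d))"
    unfolding row' using assms(2) l by simp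
  ultimately show "left_count s r (u @ [i]) = length (sigma_word s r (take n (row_word s r d))) + i"
    using left_count_row_nth lenP by metis
qed

section \<open>Prefixes of the infinite word and positions of first children\<close>

lemma row_word_Suc: "row_word s r (Suc d) = sigma_word s r (row_word s r d)"
  by (simp add: row_word_def)

lemma prefix_sigma_word: "prefix v w \<Longrightarrow> prefix (sigma_word s r v) (sigma_word s r w)"
  by (auto simp: prefix_def)

text \<open>The image of \<open>Rt\<close> begins with \<open>Rt\<close>, so row 0 is a prefix of
  row 1, and the morphism preserves prefixes.\<close>

lemma prefix_row_word: "d \<le> e \<Longrightarrow> prefix (row_word s r d) (row_word s r e)"
proof (induction e rule: dec_induct)
  case (step e)
  have "prefix (row_word s r e) (row_word s r (Suc e))" for e
  proof (induction e)
    case (Suc e)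
    then show ?case by (metis row_word_Suc prefix_sigma_word)
  qed (simp add: row_word_def prefix_def)
  with step show ?case using prefix_order.trans by blast
qed simp

lemma sigma_nonempty: "sigma s r x \<noteq> []"
  by (cases x) auto

lemma length_sigma_word: "length w \<le> length (sigma_word s r w)"
proof (induction w)
  case (Cons x w)
  have "0 < length (sigma s r x)" using sigma_nonempty[of s r x] by blast
  with Cons show ?case by (simp del: length_greater_0_conv)
qed simp

lemma length_row_word_Suc:
  assumes "s \<ge> 1"
  shows "length (row_word s r d) < length (row_word s r (Suc d))"
proof -
  have "row_word s r 0 = [Rt]" by (simp add: row_word_def)
  then obtain w where "row_word s r d = Rt # w"
    using prefix_row_word[of 0 d s r] by (auto simp: prefix_def)
  then show ?thesis using length_sigma_word[of w s r] assms by (simp add: row_word_Suc)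
qed

text \<open>Ensures that \<open>take n\<close> in \<open>word_prefix\<close> really yields
  \<open>n\<close> letters.\<close>

lemma length_row_word_gt: "s \<ge> 1 \<Longrightarrow> d < length (row_word s r d)"
proof (induction d)
  case (Suc d)
  then show ?case using length_row_word_Suc[of s r d] by linarith
qed (simp add: row_word_def)

text \<open>The prefix of length \<open>n\<close> of the infinite word of which all rows are prefixes.\<close>

definition word_prefix :: "nat \<Rightarrow> (nat \<Rightarrow> nat) \<Rightarrow> nat \<Rightarrow> letter list" where
  "word_prefix s r n = take n (row_word s r n)"

lemma take_row_word:
  assumes "s \<ge> 1" "n \<le> length (row_word s r d)"
  shows "take n (row_word s r d) = word_prefix s r n"
proof -
  have eq: "take n w = take n w'" if "prefix w w'" "n \<le> length w" for w w' :: "letter list"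
    using that by (auto simp: prefix_def)
  have "n \<le> length (row_word s r n)" using length_row_word_gt[OF assms(1), of n r] by simp
  then show ?thesis
    using eq assms(2) prefix_row_word[of n d s r] prefix_row_word[of d n s r]
    unfolding word_prefix_def by (metis linorder_linear)
qed

lemma length_word_prefix: "s \<ge> 1 \<Longrightarrow> length (word_prefix s r n) = n"
  using length_row_word_gt[of s n r] by (simp add: word_prefix_def)

text \<open>The position, in its row, of the leftmost child of a node with \<open>n\<close> nodes to
  its left.\<close>

definition first_child :: "nat \<Rightarrow> (nat \<Rightarrow> nat) \<Rightarrow> nat \<Rightarrow> nat" where
  "first_child s r n = length (sigma_word s r (word_prefix s r n))"

lemma word_prefix_Suc:
  assumes "s \<ge> 1" "n < length (row_word s r d)"
  shows "word_prefix s r (Suc n) = word_prefix s r n @ [row_word s r d ! n]"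
  using assms take_row_word[of s n r d] take_row_word[of s "Suc n" r d]
  by (simp add: take_Suc_conv_app_nth)

lemma first_child_Suc:
  assumes "s \<ge> 1" "n < length (row_word s r d)"
  shows "first_child s r (Suc n) = first_child s r n + length (sigma s r (row_word s r d ! n))"
  using word_prefix_Suc[OF assms] by (simp add: first_child_def)

lemma strict_mono_first_child: "s \<ge> 1 \<Longrightarrow> strict_mono (first_child s r)"
  using first_child_Suc[OF _ length_row_word_gt] sigma_nonempty by (simp add: strict_mono_Suc_iff)

lemma first_child_row_word:
  assumes "s \<ge> 1"
  shows "first_child s r (length (row_word s r d)) = length (row_word s r (Suc d))"
  using take_row_word[OF assms, of "length (row_word s r d)" r d]
  by (simp add: first_child_def row_word_Suc)

text \<open>The children of the node at position \<open>n\<close> fill the positions from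
  \<open>first_child s r n\<close> up to, but excluding, \<open>first_child s r (Suc n)\<close>. So
  \<open>a_R\<close> is a step function inverse to \<open>first_child\<close>.\<close>

lemma a_R_bounds:
  assumes "s \<ge> 1"
  shows "first_child s r (a_R s r (int m)) \<le> m \<and> m < first_child s r (Suc (a_R s r (int m)))"
proof -
  obtain v where v: "v \<in> nodes s r" "v \<noteq> []" "left_count s r v = m"
    using left_count_surj[OF assms] by blast
  then obtain y where "labelled_node s r v y" by (auto simp: nodes_def)
  with v obtain u x i where u: "v = u @ [i]" "labelled_node s r u x" "i < length (sigma s r x)"
    by (metis labelled_node.cases)
  have a: "a_R s r (int m) = left_count s r u"
    using a_R_left_count[of v s r] v u(1) by simp
  note lc = left_count_child[OF u(2,3) refl]
  have "m = first_child s r (left_count s r u) + i"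
    using v(3) u(1) lc(3) take_row_word[OF assms, of "left_count s r u" r "length u"] lc(1)
    by (simp add: first_child_def)
  then show ?thesis
    unfolding a using first_child_Suc[OF assms lc(1)] lc(2) u(3) by simp
qed

lemma a_R_eqI:
  assumes "s \<ge> 1" "first_child s r n \<le> m" "m < first_child s r (Suc n)"
  shows "a_R s r (int m) = n"
proof -
  have "first_child s r n < first_child s r (Suc (a_R s r (int m)))"
       "first_child s r (a_R s r (int m)) < first_child s r (Suc n)"
    using a_R_bounds[OF assms(1), of r m] assms by auto
  then show ?thesis
    using strict_mono_less[OF strict_mono_first_child[OF assms(1)]] by (metis less_Suc_eq_le order_antisym)
qed

text \<open>Exhibits quotients of consecutive row lengths as a subsequence of \<open>a(n)/n\<close>;
  the divergence proof rests on it.\<close>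

lemma a_R_row_word:
  assumes "s \<ge> 1"
  shows "a_R s r (int (length (row_word s r (Suc d)))) = length (row_word s r d)"
  using strict_mono_first_child[OF assms] first_child_row_word[OF assms]
  by (intro a_R_eqI assms) (auto simp: strict_mono_Suc_iff simp flip: first_child_row_word[OF assms])

subsection \<open>Block decomposition of the rows\<close>

definition zero_word :: "nat \<Rightarrow> (nat \<Rightarrow> nat) \<Rightarrow> nat \<Rightarrow> letter list" where
  "zero_word s r m = (sigma_word s r ^^ m) [Digit 0]"

definition zero_len :: "nat \<Rightarrow> (nat \<Rightarrow> nat) \<Rightarrow> nat \<Rightarrow> nat" where
  "zero_len s r m = length (zero_word s r m)"

text \<open>The common shape of \<open>zero_word\<close> and \<open>row_word\<close> behind their
  first letter: runs of iterated images of 0, with increasing exponent and multiplicities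
  \<open>f\<close>.\<close>

definition blocks :: "nat \<Rightarrow> (nat \<Rightarrow> nat) \<Rightarrow> (nat \<Rightarrow> nat) \<Rightarrow> nat \<Rightarrow> letter list" where
  "blocks s r f m = concat (map (\<lambda>i. concat (replicate (f i) (zero_word s r i))) [0..<m])"

lemma blocks_simps [simp]:
  "blocks s r f 0 = []"
  "blocks s r f (Suc m) = blocks s r f m @ concat (replicate (f m) (zero_word s r m))"
  by (simp_all add: blocks_def)

lemma zero_word_Suc: "zero_word s r (Suc m) = sigma_word s r (zero_word s r m)"
  by (simp add: zero_word_def)

lemma sigma_word_concat_replicate:
  "sigma_word s r (concat (replicate n w)) = concat (replicate n (sigma_word s r w))"
  by (induction n) simp_all

text \<open>The morphism raises the index of each block by one; the zeros put in front are the new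
  blocks of index 0.\<close>

lemma sigma_word_blocks:
  "replicate (f 0) (Digit 0) @ sigma_word s r (blocks s r (\<lambda>i. f (Suc i)) m) = blocks s r f (Suc m)"
proof (induction m)
  case 0
  show ?case by (induction "f 0") (simp_all add: zero_word_def)
next
  case (Suc m)
  then show ?case
    by (simp add: sigma_word_concat_replicate zero_word_Suc flip: append_assoc)
qed

text \<open>The leading letter emits \<open>r j\<close> zeros in step \<open>j\<close>, and the
  remaining \<open>m - j\<close> steps turn each of them into
  \<open>zero_word s r (m - j)\<close>.\<close>

lemma zero_word_blocks: "zero_word s r m = Digit m # blocks s r (\<lambda>i. r (m - i)) m"
proof (induction m)
  case (Suc m)
  then show ?case
    using sigma_word_blocks[of "\<lambda>i. r (Suc m - i)" s r m] by (simp add: zero_word_Suc)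
qed (simp add: zero_word_def)

lemma row_word_blocks: "row_word s r d = Rt # blocks s r (\<lambda>_. s) d"
proof (induction d)
  case (Suc d)
  then show ?case
    using sigma_word_blocks[of "\<lambda>_. s" s r d] by (simp add: row_word_Suc)
qed (simp add: row_word_def)

lemma length_blocks: "length (blocks s r f m) = (\<Sum>i<m. f i * zero_len s r i)"
  by (induction m) (simp_all add: zero_len_def length_concat sum_list_replicate)

lemma zero_len_rec: "zero_len s r m = 1 + (\<Sum>i<m. r (m - i) * zero_len s r i)"
  by (subst zero_len_def, subst zero_word_blocks) (simp add: length_blocks)

lemma zero_len_rec': "zero_len s r m = 1 + (\<Sum>i=1..m. r i * zero_len s r (m - i))"
proof -
  have "(\<Sum>i<m. r (m - i) * zero_len s r i) = (\<Sum>i=1..m. r i * zero_len s r (m - i))"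
    by (rule sum.reindex_bij_witness[of _ "\<lambda>i. m - i" "\<lambda>i. m - i"]) auto
  then show ?thesis by (subst zero_len_rec) simp
qed

lemma length_row_word: "length (row_word s r d) = 1 + s * (\<Sum>i<d. zero_len s r i)"
  by (subst row_word_blocks) (simp add: length_blocks sum_distrib_left)

lemma mono_zero_len: "mono (zero_len s r)"
proof (rule mono_iff_le_Suc[THEN iffD2], rule allI)
  fix n
  show "zero_len s r n \<le> zero_len s r (Suc n)"
  proof (induction n rule: less_induct)
    case (less n)
    have "(\<Sum>i=1..n. r i * zero_len s r (n - i)) \<le> (\<Sum>i=1..n. r i * zero_len s r (Suc n - i))"
      using less by (intro sum_mono mult_left_mono) (auto simp: Suc_diff_le)
    also have "\<dots> \<le> (\<Sum>i=1..Suc n. r i * zero_len s r (Suc n - i))" by simp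
    finally show ?case
      by (subst (1 2) zero_len_rec') simp
  qed
qed

subsection \<open>Deviation of a word from the scaling factor\<close>

text \<open>On \<open>word_prefix s r n\<close> this is \<open>n - x * first_child s r n\<close>. It
  is additive under concatenation, hence can be estimated block by block.\<close>

definition deviation :: "nat \<Rightarrow> (nat \<Rightarrow> nat) \<Rightarrow> real \<Rightarrow> letter list \<Rightarrow> real" where
  "deviation s r x w = real (length w) - x * real (length (sigma_word s r w))"

lemma deviation_simps [simp]:
  "deviation s r x [] = 0"
  "deviation s r x (v @ w) = deviation s r x v + deviation s r x w"
  by (simp_all add: deviation_def algebra_simps)

lemma deviation_Cons: "deviation s r x (a # w) = deviation s r x [a] + deviation s r x w"
  by (simp add: deviation_def algebra_simps)

lemma deviation_replicate: "deviation s r x (concat (replicate n w)) = real n * deviation s r x w"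
  by (induction n) (simp_all add: algebra_simps)

lemma deviation_zero_word:
  "deviation s r x (zero_word s r m) = real (zero_len s r m) - x * real (zero_len s r (Suc m))"
  by (simp add: deviation_def zero_len_def zero_word_Suc)

lemma deviation_blocks:
  "deviation s r x (blocks s r f m) = (\<Sum>i<m. real (f i) * deviation s r x (zero_word s r i))"
  by (induction m) (simp_all add: deviation_replicate)

lemma prefix_concat_replicate:
  assumes "prefix p (concat (replicate n w))"
  shows "\<exists>t q. t \<le> n \<and> prefix q w \<and> p = concat (replicate t w) @ q"
  using assms
proof (induction n arbitrary: p)
  case 0
  then show ?case by auto
next
  case (Suc n)
  then consider "prefix p w" | p' where "p = w @ p'" "prefix p' (concat (replicate n w))"
    by (auto simp: prefix_append)
  then show ?case
  proof cases
    case 1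
    then show ?thesis by (intro exI[of _ 0] exI[of _ p]) simp
  next
    case 2
    with Suc.IH obtain t q where "t \<le> n" "prefix q w" "p' = concat (replicate t w) @ q" by blast
    with 2 show ?thesis by (intro exI[of _ "Suc t"] exI[of _ q]) simp
  qed
qed

text \<open>A prefix consists of complete blocks and a prefix \<open>q\<close> of at most one
  further block. The complete blocks cost \<epsilon> times their length plus the errors \<kappa>,
  each taken at most \<open>B\<close> times; only \<open>q\<close> costs a multiple of
  \<open>C\<close>, and its index is below \<open>m\<close>. Assumption \<open>pre\<close> is kept
  separate because the next lemma supplies it by induction.\<close>

lemma deviation_prefix_blocks:
  fixes x \<epsilon> B C :: real and \<kappa> :: "nat \<Rightarrow> real"
  assumes f: "\<And>i. i < m \<Longrightarrow> real (f i) \<le> B" and \<epsilon>: "\<epsilon> \<ge> 0" and \<kappa>: "\<And>i. \<kappa> i \<ge> 0" and C: "C \<ge> 0" and B: "B \<ge> 0"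
    and dev: "\<And>i. \<bar>deviation s r x (zero_word s r i)\<bar> \<le> \<epsilon> * zero_len s r i + \<kappa> i"
    and pre: "\<And>i q. i < m \<Longrightarrow> prefix q (zero_word s r i) \<Longrightarrow>
                \<bar>deviation s r x q\<bar> \<le> \<epsilon> * length q + C * (i + 1)"
    and p: "prefix p (blocks s r f m)"
  shows "\<bar>deviation s r x p\<bar> \<le> \<epsilon> * length p + B * (\<Sum>i<m. \<kappa> i) + C * m"
  using f pre p
proof (induction m arbitrary: p)
  case 0
  then show ?case by simp
next
  case (Suc m)
  have \<kappa>_sum: "B * sum \<kappa> {..<m} \<le> B * sum \<kappa> {..<Suc m}"
    using \<kappa> B by (intro mult_left_mono) auto
  from Suc.prems(3) consider "prefix p (blocks s r f m)"
    | p' where "p = blocks s r f m @ p'" "prefix p' (concat (replicate (f m) (zero_word s r m)))"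
    by (auto simp: prefix_append)
  then show ?case
  proof cases
    case 1
    with Suc have "\<bar>deviation s r x p\<bar> \<le> \<epsilon> * length p + B * (\<Sum>i<m. \<kappa> i) + C * m"
      by (metis less_SucI)
    then show ?thesis using \<kappa>_sum C by (simp add: algebra_simps)
  next
    case 2
    from prefix_concat_replicate[OF 2(2)] obtain t q
      where t: "t \<le> f m" and q: "prefix q (zero_word s r m)"
        and p': "p' = concat (replicate t (zero_word s r m)) @ q" by blast
    \<comment> \<open>Serves both for the full runs, where \<open>t\<close> is \<open>f i\<close>,
      and for the run at index \<open>m\<close> that the prefix breaks off.\<close>
    have block: "real t * \<bar>deviation s r x (zero_word s r i)\<bar> \<le> \<epsilon> * (t * zero_len s r i) + B * \<kappa> i"
      if "t \<le> f i" "i \<le> m" for t i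
    proof -
      have "real t \<le> B" using that Suc.prems(1)[of i] by (simp add: order_trans[of "real t" "real (f i)"])
      then have "real t * \<kappa> i \<le> B * \<kappa> i" using \<kappa> by (intro mult_right_mono)
      moreover have "real t * \<bar>deviation s r x (zero_word s r i)\<bar> \<le> real t * (\<epsilon> * zero_len s r i + \<kappa> i)"
        using dev by (intro mult_left_mono) auto
      ultimately show ?thesis by (simp add: algebra_simps)
    qed
    have "\<bar>deviation s r x (blocks s r f m)\<bar> \<le> (\<Sum>i<m. \<bar>real (f i) * deviation s r x (zero_word s r i)\<bar>)"
      unfolding deviation_blocks by (rule sum_abs)
    also have "\<dots> \<le> (\<Sum>i<m. \<epsilon> * (f i * zero_len s r i) + B * \<kappa> i)"
      by (intro sum_mono) (use block in \<open>auto simp: abs_mult\<close>)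
    also have "\<dots> = \<epsilon> * length (blocks s r f m) + B * (\<Sum>i<m. \<kappa> i)"
      by (simp add: length_blocks sum.distrib sum_distrib_left)
    finally have 1: "\<bar>deviation s r x (blocks s r f m)\<bar> \<le> \<epsilon> * length (blocks s r f m) + B * (\<Sum>i<m. \<kappa> i)" .
    have 2: "\<bar>deviation s r x (concat (replicate t (zero_word s r m)))\<bar> \<le> \<epsilon> * (t * zero_len s r m) + B * \<kappa> m"
      using block[OF t] by (simp add: deviation_replicate abs_mult)
    have 3: "\<bar>deviation s r x q\<bar> \<le> \<epsilon> * length q + C * (m + 1)"
      using Suc.prems(2)[OF _ q] by simp
    have "length p = length (blocks s r f m) + t * zero_len s r m + length q"
      using p' \<open>p = _\<close> by (simp add: length_concat sum_list_replicate zero_len_def)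
    moreover have "deviation s r x p = deviation s r x (blocks s r f m)
        + deviation s r x (concat (replicate t (zero_word s r m))) + deviation s r x q"
      using p' \<open>p = _\<close> by simp
    ultimately show ?thesis using 1 2 3 by (simp add: algebra_simps)
  qed
qed

lemma deviation_letter:
  assumes "0 \<le> x" "x \<le> 1" "real s \<le> B" "\<And>i. i \<ge> 1 \<Longrightarrow> real (r i) \<le> B"
  shows "\<bar>deviation s r x [a]\<bar> \<le> 1 + B"
proof -
  obtain n where n: "length (sigma s r a) = 1 + n" "real n \<le> B"
    using assms by (cases a) auto
  have "x * (1 + real n) \<le> 1 * (1 + B)"
    using assms n by (intro mult_mono) auto
  moreover have "0 \<le> x * (1 + real n)" "0 \<le> B" using assms n by auto
  ultimately show ?thesis by (simp add: deviation_def n)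
qed

text \<open>Strong induction on \<open>m\<close>: behind the first letter stand blocks of smaller
  index, so the broken block falls under the induction hypothesis. The constant
  \<open>1 + B + B * K\<close> pays, at each level, for one letter and for all errors
  \<kappa>.\<close>

lemma deviation_prefix_zero_word:
  fixes x \<epsilon> B K :: real and \<kappa> :: "nat \<Rightarrow> real"
  assumes x: "0 \<le> x" "x \<le> 1" and B: "real s \<le> B" "\<And>i. i \<ge> 1 \<Longrightarrow> real (r i) \<le> B"
    and \<epsilon>: "\<epsilon> \<ge> 0" and \<kappa>: "\<And>i. \<kappa> i \<ge> 0" "\<And>m. (\<Sum>i<m. \<kappa> i) \<le> K"
    and dev: "\<And>i. \<bar>deviation s r x (zero_word s r i)\<bar> \<le> \<epsilon> * zero_len s r i + \<kappa> i"
    and p: "prefix p (zero_word s r m)"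
  shows "\<bar>deviation s r x p\<bar> \<le> \<epsilon> * length p + (1 + B + B * K) * (m + 1)"
  using p
proof (induction m arbitrary: p rule: less_induct)
  case (less m)
  have B0: "0 \<le> B" using B by linarith
  have K0: "0 \<le> K" using \<kappa>(2)[of 0] by simp
  show ?case
  proof (cases p)
    case Nil
    then show ?thesis using B0 K0 by simp
  next
    case (Cons a q)
    with less.prems have q: "prefix q (blocks s r (\<lambda>i. r (m - i)) m)"
      by (simp add: zero_word_blocks)
    have "\<bar>deviation s r x q\<bar> \<le> \<epsilon> * length q + B * (\<Sum>i<m. \<kappa> i) + (1 + B + B * K) * m"
      by (rule deviation_prefix_blocks[OF _ \<epsilon> \<kappa>(1) _ _ dev less.IH q])
         (use B B0 K0 in auto)
    moreover have "B * (\<Sum>i<m. \<kappa> i) \<le> B * K"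
      using B0 \<kappa>(2) by (intro mult_left_mono)
    moreover have "\<bar>deviation s r x [a]\<bar> \<le> 1 + B"
      by (rule deviation_letter[OF x B])
    moreover have "deviation s r x p = deviation s r x [a] + deviation s r x q"
      unfolding Cons by (rule deviation_Cons)
    ultimately show ?thesis using Cons \<epsilon> by (simp add: algebra_simps)
  qed
qed

lemma deviation_prefix_row_word:
  fixes x \<epsilon> B K :: real and \<kappa> :: "nat \<Rightarrow> real"
  assumes x: "0 \<le> x" "x \<le> 1" and B: "real s \<le> B" "\<And>i. i \<ge> 1 \<Longrightarrow> real (r i) \<le> B"
    and \<epsilon>: "\<epsilon> \<ge> 0" and \<kappa>: "\<And>i. \<kappa> i \<ge> 0" "\<And>m. (\<Sum>i<m. \<kappa> i) \<le> K"
    and dev: "\<And>i. \<bar>deviation s r x (zero_word s r i)\<bar> \<le> \<epsilon> * zero_len s r i + \<kappa> i"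
    and p: "prefix p (row_word s r d)"
  shows "\<bar>deviation s r x p\<bar> \<le> \<epsilon> * length p + (1 + B + B * K) * (d + 1)"
proof -
  have B0: "0 \<le> B" using B by linarith
  have K0: "0 \<le> K" using \<kappa>(2)[of 0] by simp
  show ?thesis
  proof (cases p)
    case Nil
    then show ?thesis using B0 K0 by simp
  next
    case (Cons a q)
    with p have q: "prefix q (blocks s r (\<lambda>_. s) d)"
      by (simp add: row_word_blocks)
    have "\<bar>deviation s r x q\<bar> \<le> \<epsilon> * length q + B * (\<Sum>i<d. \<kappa> i) + (1 + B + B * K) * d"
      by (rule deviation_prefix_blocks[OF _ \<epsilon> \<kappa>(1) _ _ dev deviation_prefix_zero_word[OF x B \<epsilon> \<kappa> dev] q])
         (use B B0 K0 in auto)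
    moreover have "B * (\<Sum>i<d. \<kappa> i) \<le> B * K"
      using B0 \<kappa>(2) by (intro mult_left_mono)
    moreover have "\<bar>deviation s r x [a]\<bar> \<le> 1 + B"
      by (rule deviation_letter[OF x B])
    moreover have "deviation s r x p = deviation s r x [a] + deviation s r x q"
      unfolding Cons by (rule deviation_Cons)
    ultimately show ?thesis using Cons \<epsilon> by (simp add: algebra_simps)
  qed
qed

section \<open>From bounds on the deviation to the limit\<close>

lemma a_R_tendsto:
  fixes x B :: real
  assumes s: "s \<ge> 1" and x: "0 \<le> x"
    and B: "real s \<le> B" "\<And>i. i \<ge> 1 \<Longrightarrow> real (r i) \<le> B"
    and dev: "\<And>\<epsilon>. \<epsilon> > 0 \<Longrightarrow> \<exists>K. \<forall>n. \<bar>real n - x * real (first_child s r n)\<bar> \<le> \<epsilon> * real n + K"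
  shows "(\<lambda>n. real (a_R s r (int n)) / real n) \<longlonglongrightarrow> x"
proof (rule LIMSEQ_I)
  fix \<epsilon> :: real assume \<epsilon>: "\<epsilon> > 0"
  then obtain K where K: "\<And>n. \<bar>real n - x * real (first_child s r n)\<bar> \<le> \<epsilon> / 2 * real n + K"
    using dev[of "\<epsilon> / 2"] by auto
  define K' where "K' = \<bar>K\<bar> + x * (1 + B)"
  have B0: "0 \<le> B" using B by linarith
  \<comment> \<open>With \<open>n\<close> the value of \<open>a_R\<close> at \<open>m\<close>, the
    position \<open>m\<close> differs from \<open>first_child s r n\<close> by at most
    \<open>1 + B\<close>. Replacing one by the other costs the second summand of
    \<open>K'\<close>.\<close>
  have *: "\<bar>real (a_R s r (int m)) - x * real m\<bar> \<le> \<epsilon> / 2 * real m + K'" for m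
  proof -
    define n where "n = a_R s r (int m)"
    have b: "first_child s r n \<le> m" "m < first_child s r (Suc n)"
      using a_R_bounds[OF s, of r m] by (auto simp: n_def)
    have "real (length (sigma s r y)) \<le> 1 + B" for y
      using B by (cases y) auto
    then have "real (first_child s r (Suc n)) \<le> real (first_child s r n) + (1 + B)"
      using first_child_Suc[OF s length_row_word_gt[OF s]] by simp
    with b have d: "\<bar>real (first_child s r n) - real m\<bar> \<le> 1 + B" by linarith
    have "n \<le> m" using b(1) strict_mono_imp_increasing[OF strict_mono_first_child[OF s], of n r] by simp
    then have "\<epsilon> / 2 * real n \<le> \<epsilon> / 2 * real m" using \<epsilon> by (intro mult_left_mono) auto
    moreover have "\<bar>x * (real (first_child s r n) - real m)\<bar> \<le> x * (1 + B)"
      unfolding abs_mult using d x by (simp add: mult_left_mono)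
    ultimately show ?thesis
      using K[of n] unfolding K'_def n_def[symmetric] by (simp add: algebra_simps)
  qed
  obtain N :: nat where N: "real N > 2 * K' / \<epsilon>" "N \<ge> 1"
    using reals_Archimedean2[of "max 1 (2 * K' / \<epsilon>)"] by auto
  show "\<exists>no. \<forall>n\<ge>no. norm (real (a_R s r (int n)) / real n - x) < \<epsilon>"
  proof (intro exI allI impI)
    fix n assume n: "n \<ge> N"
    then have n0: "real n > 0" "2 * K' / \<epsilon> < real n" using N by auto
    have "K' < \<epsilon> / 2 * real n" using n0(2) \<epsilon> by (simp add: field_simps)
    then have "\<bar>real (a_R s r (int n)) - x * real n\<bar> < \<epsilon> * real n"
      using *[of n] by (simp add: field_simps)
    moreover have "real (a_R s r (int n)) / real n - x = (real (a_R s r (int n)) - x * real n) / real n"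
      using n0 by (simp add: field_simps)
    ultimately show "norm (real (a_R s r (int n)) / real n - x) < \<epsilon>"
      using n0 by (simp add: field_simps)
  qed
qed

text \<open>When \<open>zero_len\<close> tends to infinity, \<open>M\<close> can be taken
  arbitrarily large. The depth is then negligible against the row length, which absorbs error terms
  linear in the depth.\<close>

lemma row_word_superlinear:
  assumes s: "s \<ge> 1" and M: "0 \<le> M" and c: "\<And>i. i \<ge> J \<Longrightarrow> M \<le> real (zero_len s r i)"
  shows "M * (real d - real J) \<le> real (length (row_word s r d))"
proof (induction d)
  case 0
  have "M * (real 0 - real J) \<le> 0" using M by (simp add: mult_nonneg_nonpos)
  then show ?case by linarith
next
  case (Suc d)
  show ?case
  proof (cases "d < J")
    case True
    then have "M * (real (Suc d) - real J) \<le> 0" using M by (simp add: mult_nonneg_nonpos)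
    then show ?thesis by linarith
  next
    case False
    then have "M \<le> real (zero_len s r d)" using c by simp
    moreover have "1 * zero_len s r d \<le> s * zero_len s r d" using s by (intro mult_right_mono) auto
    ultimately have "M \<le> real (s * zero_len s r d)" by linarith
    with Suc show ?thesis by (simp add: length_row_word algebra_simps)
  qed
qed

lemma a_R_tendsto_of_zero_len:
  fixes x B :: real
  assumes s: "s \<ge> 1" and x: "0 \<le> x" "x \<le> 1"
    and B: "real s \<le> B" "\<And>i. i \<ge> 1 \<Longrightarrow> real (r i) \<le> B"
    and ratio: "\<And>\<epsilon>::real. \<epsilon> > 0 \<Longrightarrow> eventually (\<lambda>n.
        \<bar>real (zero_len s r n) - x * real (zero_len s r (Suc n))\<bar> \<le> \<epsilon> * zero_len s r n) sequentially"
    and top: "filterlim (\<lambda>n. real (zero_len s r n)) at_top sequentially"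
  shows "(\<lambda>n. real (a_R s r (int n)) / real n) \<longlonglongrightarrow> x"
proof (rule a_R_tendsto[OF s x(1) B])
  fix \<epsilon> :: real assume \<epsilon>: "\<epsilon> > 0"
  let ?e = "\<lambda>n. \<bar>deviation s r x (zero_word s r n)\<bar>"
  obtain N where N: "\<And>n. n \<ge> N \<Longrightarrow> ?e n \<le> \<epsilon> / 2 * zero_len s r n"
    using ratio[of "\<epsilon> / 2"] \<epsilon> by (auto simp: eventually_sequentially deviation_zero_word)
  \<comment> \<open>The ratio condition holds only from \<open>N\<close> on; \<kappa> takes up the
    finitely many earlier deviations, so its partial sums stay bounded.\<close>
  define \<kappa> where "\<kappa> n = (if n < N then ?e n else 0)" for n
  define K where "K = sum ?e {..<N}"
  have \<kappa>: "0 \<le> \<kappa> n" for n by (simp add: \<kappa>_def)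
  have K: "sum \<kappa> {..<m} \<le> K" for m
  proof -
    have "sum \<kappa> {..<m} = sum \<kappa> ({..<m} \<inter> {..<N})"
      by (rule sum.mono_neutral_right) (auto simp: \<kappa>_def)
    also have "\<dots> \<le> sum \<kappa> {..<N}" by (rule sum_mono2) (auto simp: \<kappa>)
    also have "\<dots> = K" unfolding K_def by (rule sum.cong) (auto simp: \<kappa>_def)
    finally show ?thesis .
  qed
  have dev: "?e n \<le> \<epsilon> / 2 * zero_len s r n + \<kappa> n" for n
    using N[of n] \<epsilon> by (cases "n < N") (auto simp: \<kappa>_def)
  define C where "C = 1 + B + B * K"
  have "0 \<le> B" "0 \<le> K" using B K[of 0] by auto
  then have C: "C > 0" unfolding C_def by (simp add: add_pos_nonneg)
  have "eventually (\<lambda>n. 2 * C / \<epsilon> \<le> real (zero_len s r n)) sequentially"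
    using top by (simp add: filterlim_at_top)
  then obtain J where J: "\<And>n. n \<ge> J \<Longrightarrow> 2 * C / \<epsilon> \<le> real (zero_len s r n)"
    by (auto simp: eventually_sequentially)
  show "\<exists>K. \<forall>n. \<bar>real n - x * real (first_child s r n)\<bar> \<le> \<epsilon> * real n + K"
  proof (intro exI allI)
    fix n
    \<comment> \<open>Minimality makes row \<open>d - 1\<close> shorter than \<open>n\<close>, so
      \<open>d\<close> is bounded in terms of \<open>n\<close>.\<close>
    define d where "d = (LEAST d. n \<le> length (row_word s r d))"
    have "n \<le> length (row_word s r n)" using length_row_word_gt[OF s, of n r] by simp
    then have d: "n \<le> length (row_word s r d)" unfolding d_def by (rule LeastI)
    have "prefix (word_prefix s r n) (row_word s r d)"
      using take_row_word[OF s d] take_is_prefix by metis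
    from deviation_prefix_row_word[OF x B _ \<kappa> K dev this] \<epsilon>
    have "\<bar>deviation s r x (word_prefix s r n)\<bar> \<le> \<epsilon> / 2 * n + C * (d + 1)"
      by (simp add: C_def length_word_prefix[OF s])
    moreover have "C * d \<le> \<epsilon> / 2 * n + C * (J + 1)"
    proof (cases d)
      case 0
      then show ?thesis using \<epsilon> C by simp
    next
      case (Suc d')
      have "\<not> n \<le> length (row_word s r d')"
        using not_less_Least[of d' "\<lambda>d. n \<le> length (row_word s r d)"] Suc unfolding d_def[symmetric] by simp
      moreover have "2 * C / \<epsilon> * (real d' - real J) \<le> real (length (row_word s r d'))"
        by (rule row_word_superlinear[OF s _ J]) (use C \<epsilon> in auto)
      ultimately have "2 * C / \<epsilon> * (real d' - real J) \<le> real n" by linarith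
      then have "C * (real d' - real J) \<le> \<epsilon> / 2 * real n" using \<epsilon> by (simp add: field_simps)
      then show ?thesis using Suc by (simp add: algebra_simps)
    qed
    moreover have "deviation s r x (word_prefix s r n) = real n - x * real (first_child s r n)"
      by (simp add: deviation_def first_child_def length_word_prefix[OF s])
    ultimately show "\<bar>real n - x * real (first_child s r n)\<bar> \<le> \<epsilon> * real n + (C * (J + 1) + C)"
      by (simp add: algebra_simps)
  qed
qed

subsection \<open>Limits in the case of bounded or linear growth\<close>

lemma zero_len_step:
  assumes "1 \<le> i" "i \<le> m"
  shows "1 + r i * zero_len s r (m - i) \<le> zero_len s r m"
proof -
  have "r i * zero_len s r (m - i) \<le> (\<Sum>i=1..m. r i * zero_len s r (m - i))"
    by (rule member_le_sum) (use assms in auto)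
  then show ?thesis by (subst (2) zero_len_rec') simp
qed

text \<open>Along multiples of \<open>i\<close> each step adds at least 1; monotonicity covers the
  indices in between.\<close>

lemma zero_len_at_top:
  assumes "1 \<le> i" "1 \<le> r i"
  shows "filterlim (\<lambda>n. real (zero_len s r n)) at_top sequentially"
proof -
  have ge: "j \<le> zero_len s r (i * j)" for j
  proof (induction j)
    case (Suc j)
    have "1 * zero_len s r (i * j) \<le> r i * zero_len s r (i * j)"
      using assms by (intro mult_right_mono) auto
    moreover have "1 + r i * zero_len s r (i * j) \<le> zero_len s r (i * Suc j)"
      using zero_len_step[of i "i * Suc j" r s] assms(1) by simp
    ultimately show ?case using Suc by linarith
  qed simp
  have "eventually (\<lambda>n. Z \<le> real (zero_len s r n)) sequentially" for Z
  proof -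
    obtain j :: nat where "Z \<le> real j" using real_arch_simple by blast
    then have "Z \<le> real (zero_len s r n)" if "n \<ge> i * j" for n
      using monoD[OF mono_zero_len that, of s r] ge[of j] by linarith
    then show ?thesis by (auto simp: eventually_sequentially)
  qed
  then show ?thesis by (simp add: filterlim_at_top)
qed

text \<open>Here \<open>zero_len\<close> is constantly 1, so the criterion
  \<open>a_R_tendsto_of_zero_len\<close> does not apply. Instead, the morphism lengthens only the
  letter \<open>Rt\<close>, which occurs once, so \<open>first_child s r n\<close> is
  \<open>n + s\<close> for positive \<open>n\<close>.\<close>

lemma a_R_tendsto_sum_0:
  assumes s: "s \<ge> 1" and r: "\<And>i. i \<ge> 1 \<Longrightarrow> r i = 0"
  shows "(\<lambda>n. real (a_R s r (int n)) / real n) \<longlonglongrightarrow> 1"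
proof (rule a_R_tendsto[OF s, where B = "real s"])
  fix \<epsilon> :: real assume "\<epsilon> > 0"
  have len: "length (sigma_word s r w) = length w" if "Rt \<notin> set w" for w
    using that
  proof (induction w)
    case (Cons a w)
    then show ?case by (cases a) (auto simp: r)
  qed simp
  have no_Rt: "Rt \<notin> set (blocks s r f m)" for f m
  proof -
    have "Rt \<notin> set (zero_word s r i)" for i
    proof (induction i)
      case (Suc i)
      have "Rt \<notin> set (sigma_word s r w)" if "Rt \<notin> set w" for w
        using that
      proof (induction w)
        case (Cons a w)
        then show ?case by (cases a) auto
      qed simp
      with Suc show ?case by (simp add: zero_word_Suc)
    qed (simp add: zero_word_def)
    then show ?thesis by (auto simp: blocks_def)
  qed
  have "\<bar>real n - 1 * real (first_child s r n)\<bar> \<le> \<epsilon> * real n + real s" for n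
  proof (cases n)
    case 0
    then show ?thesis by (simp add: first_child_def word_prefix_def)
  next
    case (Suc m)
    have "word_prefix s r n = Rt # take m (blocks s r (\<lambda>_. s) n)"
      using Suc by (simp add: word_prefix_def row_word_blocks)
    moreover have "Rt \<notin> set (take m (blocks s r (\<lambda>_. s) n))"
      using no_Rt in_set_takeD by fast
    ultimately have "first_child s r n = n + s"
      using len length_word_prefix[OF s, of r n] by (simp add: first_child_def)
    then show ?thesis using \<open>\<epsilon> > 0\<close> by simp
  qed
  then show "\<exists>K. \<forall>n. \<bar>real n - 1 * real (first_child s r n)\<bar> \<le> \<epsilon> * real n + K" by blast
qed (use r in auto)

text \<open>The recurrence collapses to a single term, so \<open>zero_len\<close> tends to infinity
  while growing by at most 1 per step.\<close>

lemma a_R_tendsto_sum_1: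
  assumes s: "s \<ge> 1" and i: "i \<ge> 1" "r i = 1" and r: "\<And>j. j \<ge> 1 \<Longrightarrow> j \<noteq> i \<Longrightarrow> r j = 0"
  shows "(\<lambda>n. real (a_R s r (int n)) / real n) \<longlonglongrightarrow> 1"
proof (rule a_R_tendsto_of_zero_len[OF s, where B = "real s"])
  have top: "filterlim (\<lambda>n. real (zero_len s r n)) at_top sequentially"
    by (rule zero_len_at_top) (use i in auto)
  then show "filterlim (\<lambda>n. real (zero_len s r n)) at_top sequentially" .
  have rec: "zero_len s r m = (if i \<le> m then 1 + zero_len s r (m - i) else 1)" for m
  proof -
    have "(\<Sum>j=1..m. r j * zero_len s r (m - j)) = (\<Sum>j=1..m. if j = i then zero_len s r (m - i) else 0)"
      by (rule sum.cong) (use i r in auto)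
    then show ?thesis using i by (subst zero_len_rec') auto
  qed
  have step: "zero_len s r (Suc m) \<le> zero_len s r m + 1" for m
  proof (induction m rule: less_induct)
    case (less m)
    consider "i \<le> m" | "i = Suc m" | "i > Suc m" by linarith
    then show ?case
    proof cases
      case 1
      then show ?thesis
        using less[of "m - i"] i rec[of m] rec[of "Suc m"] by (simp add: Suc_diff_le)
    next
      case 2
      then show ?thesis using rec[of m] rec[of "Suc m"] rec[of 0] i by simp
    next
      case 3
      then show ?thesis using rec[of m] rec[of "Suc m"] by simp
    qed
  qed
  fix \<epsilon> :: real assume "\<epsilon> > 0"
  have "eventually (\<lambda>n. 1 / \<epsilon> \<le> real (zero_len s r n)) sequentially"
    using top by (simp add: filterlim_at_top)
  then show "eventually (\<lambda>n. \<bar>real (zero_len s r n) - 1 * real (zero_len s r (Suc n))\<bar>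
      \<le> \<epsilon> * zero_len s r n) sequentially"
  proof eventually_elim
    case (elim n)
    then have "1 \<le> \<epsilon> * zero_len s r n" using \<open>\<epsilon> > 0\<close> by (simp add: field_simps)
    moreover have "zero_len s r n \<le> zero_len s r (Suc n)" using mono_zero_len by (rule monoD) simp
    ultimately show ?case using step[of n] by linarith
  qed
next
  fix j :: nat assume "j \<ge> 1"
  then show "real (r j) \<le> real s" using s i r[of j] by (cases "j = i") auto
qed auto

subsection \<open>Divergence for a nontrivial greatest common divisor\<close>

lemma a_R_not_convergent:
  assumes s: "s \<ge> 1" and N: "(\<Sum>i=1..N. r i) \<ge> 2" and gcd: "Gcd {i. i \<ge> 1 \<and> r i \<ge> 1} \<noteq> 1"
  shows "\<not> (\<lambda>n. real (a_R s r (int n)) / real n) \<longlonglongrightarrow> L"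
proof
  assume lim: "(\<lambda>n. real (a_R s r (int n)) / real n) \<longlonglongrightarrow> L"
  define A where "A d = real (length (row_word s r d))" for d
  define q where "q d = A d / A (Suc d)" for d
  have A_pos: "A d > 0" for d using length_row_word_gt[OF s, of d r] by (auto simp: A_def)
  \<comment> \<open>Row lengths as arguments: the quotients \<open>q\<close> of consecutive row
    lengths inherit the limit \<open>L\<close>.\<close>
  have "strict_mono (\<lambda>d. length (row_word s r (Suc d)))"
    using length_row_word_Suc[OF s] by (simp add: strict_mono_Suc_iff)
  from LIMSEQ_subseq_LIMSEQ[OF lim this] have q: "q \<longlonglongrightarrow> L"
    by (simp add: comp_def a_R_row_word[OF s] q_def[abs_def] A_def)
  define g where "g = Gcd {i. i \<ge> 1 \<and> r i \<ge> 1}"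
  have "\<exists>i\<in>{1..N}. r i \<noteq> 0" using N by (metis not_numeral_le_zero sum.neutral)
  then have "{i. i \<ge> 1 \<and> r i \<ge> 1} - {0} \<noteq> {}" by auto
  then have "g \<noteq> 0" by (auto simp: g_def)
  with gcd have g: "g \<ge> 2" unfolding g_def[symmetric] by linarith
  have dvd: "g dvd i" if "i \<ge> 1" "r i \<noteq> 0" for i
    unfolding g_def using that by (intro Gcd_dvd) auto
  \<comment> \<open>In the recurrence only multiples \<open>i\<close> of \<open>g\<close>
    contribute, and subtracting such an \<open>i\<close> from \<open>Suc n\<close> leaves a number
    not divisible by \<open>g\<close>.\<close>
  have flat: "zero_len s r (Suc n) = zero_len s r n" if "\<not> g dvd Suc n" for n
    using that
  proof (induction n rule: less_induct)
    case (less n)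
    have "(\<Sum>i=1..Suc n. r i * zero_len s r (Suc n - i)) = (\<Sum>i=1..n. r i * zero_len s r (Suc n - i))"
      using dvd[of "Suc n"] less.prems by auto
    also have "\<dots> = (\<Sum>i=1..n. r i * zero_len s r (n - i))"
    proof (rule sum.cong[OF refl])
      fix i assume i: "i \<in> {1..n}"
      show "r i * zero_len s r (Suc n - i) = r i * zero_len s r (n - i)"
      proof (cases "r i = 0")
        case False
        with i dvd have "g dvd i" by simp
        with less.prems have "\<not> g dvd Suc n - i"
          using i by (metis atLeastAtMost_iff dvd_diffD le_SucI)
        with less.IH[of "n - i"] i show ?thesis by (simp add: Suc_diff_le)
      qed simp
    qed
    finally show ?case by (subst (1 2) zero_len_rec') simp
  qed
  \<comment> \<open>Since \<open>g\<close> is at least 2, \<open>zero_len\<close> agrees at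
    \<open>g * m\<close> and \<open>Suc (g * m)\<close>, so three consecutive row lengths are in
    arithmetic progression. Dividing by the largest expresses this through \<open>q\<close>; in the
    limit it reads \<open>(1 - L)^2 = 0\<close>.\<close>
  have q_rec: "1 - q (Suc (g * m)) = q (Suc (g * m)) - q (g * m) * q (Suc (g * m))" for m
  proof -
    have "\<not> g dvd Suc (g * m)"
      using g dvd_add_right_iff[of g "g * m" 1] by simp
    then have "A (Suc (Suc (g * m))) - A (Suc (g * m)) = A (Suc (g * m)) - A (g * m)"
      by (simp add: A_def length_row_word flat algebra_simps)
    then have "(A (Suc (Suc (g * m))) - A (Suc (g * m))) / A (Suc (Suc (g * m)))
        = (A (Suc (g * m)) - A (g * m)) / A (Suc (Suc (g * m)))" by simp
    then show ?thesis using A_pos[of "Suc (g * m)"] A_pos[of "Suc (Suc (g * m))"]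
      by (simp add: q_def field_simps)
  qed
  have sub: "strict_mono (\<lambda>m. g * m)" "strict_mono (\<lambda>m. Suc (g * m))"
    using g by (auto simp: strict_mono_def)
  have a: "(\<lambda>m. 1 - q (Suc (g * m))) \<longlonglongrightarrow> 1 - L"
    using LIMSEQ_subseq_LIMSEQ[OF q sub(2)] by (intro tendsto_intros) (simp add: comp_def)
  have b: "(\<lambda>m. q (Suc (g * m)) - q (g * m) * q (Suc (g * m))) \<longlonglongrightarrow> L - L * L"
    using LIMSEQ_subseq_LIMSEQ[OF q sub(1)] LIMSEQ_subseq_LIMSEQ[OF q sub(2)]
    by (intro tendsto_intros) (simp_all add: comp_def)
  have "1 - L = L - L * L" by (rule LIMSEQ_unique[OF a b[folded q_rec]])
  then have "(1 - L) * (1 - L) = 0" by (simp add: algebra_simps)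
  then have L: "L = 1" by simp
  \<comment> \<open>Rows at least double over \<open>N\<close> levels, whereas \<open>L = 1\<close>
    forces the quotient of row lengths \<open>N\<close> levels apart to tend to 1.\<close>
  have double: "2 * A d \<le> A (d + N)" for d
  proof -
    have grow: "2 * zero_len s r n \<le> zero_len s r (n + N)" for n
    proof -
      have "2 * zero_len s r n \<le> (\<Sum>i=1..N. r i) * zero_len s r n" using N by (rule mult_right_mono) simp
      also have "\<dots> = (\<Sum>i=1..N. r i * zero_len s r n)" by (rule sum_distrib_right)
      also have "\<dots> \<le> (\<Sum>i=1..N. r i * zero_len s r (n + N - i))"
        by (intro sum_mono mult_left_mono monoD[OF mono_zero_len]) auto
      also have "\<dots> \<le> (\<Sum>i=1..n+N. r i * zero_len s r (n + N - i))"
        by (intro sum_mono2) auto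
      also have "\<dots> \<le> zero_len s r (n + N)" by (subst (2) zero_len_rec') simp
      finally show ?thesis .
    qed
    have "N \<noteq> 0" using N by (cases N) auto
    have "2 * length (row_word s r d) \<le> length (row_word s r (d + N))"
    proof (induction d)
      case 0
      have "2 \<le> length (row_word s r N)" using length_row_word_gt[OF s, of N r] \<open>N \<noteq> 0\<close> by linarith
      then show ?case by (simp add: row_word_def)
    next
      case (Suc d)
      have "s * (2 * zero_len s r d) \<le> s * zero_len s r (d + N)" using grow by simp
      then have "2 * (s * zero_len s r d) \<le> s * zero_len s r (d + N)" by (simp only: mult.left_commute)
      moreover have "length (row_word s r (Suc n)) = length (row_word s r n) + s * zero_len s r n" for n
        by (simp add: length_row_word distrib_left)
      note this[of d] this[of "d + N"]
      ultimately show ?case using Suc unfolding add_Suc by linarith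
    qed
    then show ?thesis unfolding A_def by linarith
  qed
  have "(\<lambda>d. A d / A (d + n)) \<longlonglongrightarrow> 1" for n
  proof (induction n)
    case 0
    then show ?case using A_pos by (simp add: less_imp_neq[symmetric])
  next
    case (Suc n)
    have "(\<lambda>d. q (d + n)) \<longlonglongrightarrow> 1" using LIMSEQ_ignore_initial_segment[OF q] L by simp
    from tendsto_mult[OF Suc this] show ?case
      using A_pos by (simp add: q_def less_imp_neq[symmetric])
  qed
  from this[of N] have "1 \<le> (1/2 :: real)"
  proof (rule LIMSEQ_le_const2)
    show "\<exists>n0. \<forall>d\<ge>n0. A d / A (d + N) \<le> 1 / 2"
      using double A_pos by (simp add: field_simps)
  qed
  then show False by simp
qed

subsection \<open>The limit polynomial\<close>

definition root_coeff :: "(nat \<Rightarrow> nat) \<Rightarrow> nat \<Rightarrow> real" where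
  "root_coeff r n = (if n = 0 then -1 else real (r n))"

text \<open>The multiplicative order of \<open>w\<close> divides every exponent in \<open>S\<close>,
  hence also their gcd.\<close>

lemma eq_1_of_powers_eq_1:
  fixes w :: complex
  assumes "Gcd S = (1::nat)" "\<And>i. i \<in> S \<Longrightarrow> w ^ i = 1"
  shows "w = 1"
proof -
  obtain i where i: "i \<in> S" "i \<noteq> 0"
    using assms(1) Gcd_0_iff[of S] by (metis One_nat_def Zero_not_Suc singletonI subset_iff)
  define n where "n = (LEAST n. 0 < n \<and> w ^ n = 1)"
  have "0 < i \<and> w ^ i = 1" using i assms(2) by simp
  then have n: "0 < n" "w ^ n = 1"
    unfolding n_def using LeastI[of "\<lambda>n. 0 < n \<and> w ^ n = 1"] by blast+
  have "n dvd j" if "j \<in> S" for j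
  proof (rule ccontr)
    assume "\<not> n dvd j"
    then have "0 < j mod n" by (simp add: mod_greater_zero_iff_not_dvd)
    moreover have "w ^ j = (w ^ n) ^ (j div n) * w ^ (j mod n)"
      by (simp flip: power_mult power_add)
    then have "w ^ (j mod n) = 1" using n assms(2)[OF that] by simp
    ultimately have "n \<le> j mod n" unfolding n_def by (intro Least_le) simp
    then show False using n mod_less_divisor[of n j] by linarith
  qed
  then have "n dvd Gcd S" by (rule Gcd_greatest)
  then show ?thesis using assms(1) n by simp
qed

context
  fixes r :: "nat \<Rightarrow> nat" and k :: nat
  assumes const: "\<And>i. i \<ge> k + 1 \<Longrightarrow> r i = r (k + 1)"
begin

text \<open>The polynomial is \<open>1 - x\<close> times the full power series with coefficients
  \<open>root_coeff r\<close>: the constant tail cancels beyond index \<open>k + 1\<close>, and its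
  start is the extra term of \<open>limit_poly\<close>.\<close>

lemma coeff_limit_poly:
  "coeff (limit_poly r k) n = root_coeff r n - (if n = 0 then 0 else root_coeff r (n - 1))"
proof -
  have c: "coeff (\<Sum>i\<le>k. monom (if i = 0 then -1 else real (r i)) i) n = (if n \<le> k then root_coeff r n else 0)" for n
    by (simp add: coeff_sum root_coeff_def if_distrib[of "\<lambda>x. x = _"] sum.delta cong: if_cong)
  show ?thesis
  proof (cases n)
    case 0
    then show ?thesis by (simp add: limit_poly_def c root_coeff_def)
  next
    case (Suc m)
    have r: "r (Suc m) = r (k + 1)" if "m \<ge> k" using const[of "Suc m"] that by simp
    have r': "r m = r (k + 1)" if "m > k" using const[of m] that by simp
    show ?thesis
    proof (cases m k rule: linorder_cases)
      case less
      then show ?thesis using Suc by (simp add: limit_poly_def c root_coeff_def)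
    next
      case equal
      then show ?thesis using Suc by (simp add: limit_poly_def c root_coeff_def)
    next
      case greater
      then show ?thesis using Suc r r' by (simp add: limit_poly_def c root_coeff_def)
    qed
  qed
qed

lemma bounded_of_eventually_const: "\<exists>B. \<forall>i\<ge>1. real (r i) \<le> B"
proof (intro exI allI impI)
  fix i :: nat
  have "r i \<le> Max (r ` {..k+1})"
    using const[of i] by (cases "i \<le> k + 1") auto
  then show "real (r i) \<le> real (Max (r ` {..k+1}))" by simp
qed

lemma summable_root_coeff:
  fixes z :: "'a :: {real_normed_field, banach}"
  assumes "norm z < 1"
  shows "summable (\<lambda>n. norm (of_real (root_coeff r n) * z ^ n))"
proof -
  obtain B where B: "\<And>i. i \<ge> 1 \<Longrightarrow> real (r i) \<le> B" using bounded_of_eventually_const by auto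
  have "\<bar>root_coeff r n\<bar> \<le> max 1 B" for n
    using B[of n] by (cases n) (auto simp: root_coeff_def)
  then have le: "norm (norm (of_real (root_coeff r n) * z ^ n)) \<le> max 1 B * norm z ^ n" for n
    by (simp add: norm_mult norm_power mult_right_mono)
  have "summable (\<lambda>n. max 1 B * norm z ^ n)"
    using assms by (intro summable_mult summable_geometric) simp
  then show ?thesis using le by (rule summable_comparison_test')
qed

text \<open>Stated over a general normed field because real roots and complex roots are both
  needed.\<close>

lemma poly_limit_poly_sums:
  fixes z :: "'a :: {real_normed_field, banach}"
  assumes "norm z < 1"
  shows "poly (map_poly of_real (limit_poly r k)) z = (1 - z) * (\<Sum>n. of_real (root_coeff r n) * z ^ n)"
proof -
  let ?u = "\<lambda>n. of_real (root_coeff r n) * z ^ n"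
  let ?p = "map_poly of_real (limit_poly r k) :: 'a poly"
  have s: "?u sums suminf ?u"
    by (rule summable_sums[OF summable_norm_cancel[OF summable_root_coeff[OF assms]]])
  have "(\<lambda>n. if n = 0 then 0 else z * ?u (n - 1)) sums (z * suminf ?u)"
    using sums_mult[OF s, of z] sums_Suc_iff[of "\<lambda>n. if n = 0 then 0 else z * ?u (n - 1)" "z * suminf ?u"] by simp
  from sums_diff[OF s this] have "(\<lambda>n. coeff ?p n * z ^ n) sums (suminf ?u - z * suminf ?u)"
    by (rule sums_cong[THEN iffD1, rotated])
       (auto simp: coeff_map_poly coeff_limit_poly algebra_simps gr0_conv_Suc)
  moreover have "(\<lambda>n. coeff ?p n * z ^ n) sums poly ?p z"
    unfolding poly_altdef by (rule sums_finite) (auto simp: coeff_eq_0)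
  ultimately have "poly ?p z = suminf ?u - z * suminf ?u" by (rule sums_unique2[symmetric])
  then show ?thesis by (simp add: algebra_simps)
qed

lemma poly_limit_poly_real:
  fixes y :: real
  assumes "0 \<le> y" "y < 1"
  shows "poly (limit_poly r k) y = (1 - y) * (\<Sum>n. root_coeff r n * y ^ n)"
proof -
  have "map_poly of_real (limit_poly r k) = limit_poly r k"
    by (intro poly_eqI) (simp add: coeff_map_poly)
  then show ?thesis using poly_limit_poly_sums[of y] assms by simp
qed

lemma summable_root_coeff_real: "0 \<le> y \<Longrightarrow> y < 1 \<Longrightarrow> summable (\<lambda>n. root_coeff r n * y ^ n)" for y :: real
  by (rule summable_norm_cancel) (use summable_root_coeff[of y] in simp)

text \<open>The constant terms cancel and all others increase with the argument, so term
  \<open>i\<close> alone gives the bound. The factor \<open>x - y\<close> later shows that the root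
  is simple.\<close>

lemma root_coeff_series_less:
  fixes y x :: real
  assumes "0 \<le> y" "y < x" "x < 1" "i \<ge> 1" "r i \<ge> 1"
  shows "(x - y) * x ^ (i - 1) \<le> (\<Sum>n. root_coeff r n * x ^ n) - (\<Sum>n. root_coeff r n * y ^ n)"
proof -
  have s: "summable (\<lambda>n. root_coeff r n * x ^ n - root_coeff r n * y ^ n)"
    using assms by (intro summable_diff summable_root_coeff_real) auto
  have nonneg: "0 \<le> root_coeff r n * x ^ n - root_coeff r n * y ^ n" for n
    using assms power_mono[of y x n] by (simp add: root_coeff_def mult_left_mono)
  have "y ^ i \<le> y * x ^ (i - 1)"
    using assms power_mono[of y x "i - 1"] by (cases i) (auto intro: mult_left_mono)
  then have "(x - y) * x ^ (i - 1) \<le> x ^ i - y ^ i"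
    using assms by (cases i) (auto simp: algebra_simps)
  also have "1 * (x ^ i - y ^ i) \<le> real (r i) * (x ^ i - y ^ i)"
    using assms power_mono[of y x i] by (intro mult_right_mono) auto
  also have "\<dots> = root_coeff r i * x ^ i - root_coeff r i * y ^ i"
    using assms by (simp add: root_coeff_def algebra_simps)
  also have "\<dots> \<le> (\<Sum>n. root_coeff r n * x ^ n - root_coeff r n * y ^ n)"
    using sum_le_suminf[OF s, of "{i}"] nonneg by simp
  also have "\<dots> = (\<Sum>n. root_coeff r n * x ^ n) - (\<Sum>n. root_coeff r n * y ^ n)"
    using assms by (intro suminf_diff[symmetric] summable_root_coeff_real) auto
  finally show ?thesis by simp
qed

lemma smallest_positive_root_limit_poly:
  assumes "0 < x" "x < 1" "poly (limit_poly r k) x = 0" "i \<ge> 1" "r i \<ge> 1"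
  shows "smallest_positive_root (limit_poly r k) x"
  unfolding smallest_positive_root_def
proof (intro conjI allI impI)
  fix y :: real assume y: "y > 0 \<and> poly (limit_poly r k) y = 0"
  show "x \<le> y"
  proof (rule ccontr)
    assume "\<not> x \<le> y"
    with y assms poly_limit_poly_real[of y] poly_limit_poly_real[of x]
    have "(\<Sum>n. root_coeff r n * x ^ n) - (\<Sum>n. root_coeff r n * y ^ n) = 0" by simp
    moreover have "0 < (x - y) * x ^ (i - 1)" using \<open>\<not> x \<le> y\<close> assms by simp
    moreover have "(x - y) * x ^ (i - 1) \<le>
        (\<Sum>n. root_coeff r n * x ^ n) - (\<Sum>n. root_coeff r n * y ^ n)"
      using \<open>\<not> x \<le> y\<close> assms y by (intro root_coeff_series_less) auto
    ultimately show False by linarith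
  qed
qed (use assms in auto)

text \<open>At 1 the series may diverge, but a partial sum with value at least 2 there stays above 1
  slightly to the left. This makes the polynomial positive at some \<open>y < 1\<close>, while it is
  -1 at 0.\<close>

lemma limit_poly_root_exists:
  assumes N: "(\<Sum>i=1..N. r i) \<ge> 2"
  shows "\<exists>x. 0 < x \<and> x < 1 \<and> poly (limit_poly r k) x = 0"
proof -
  define F where "F y = (\<Sum>i=1..N. real (r i) * y ^ i)" for y :: real
  have "F \<midarrow>1\<rightarrow> F 1"
    unfolding F_def by (intro tendsto_intros)
  then have "(F \<longlongrightarrow> F 1) (at_left 1)" by (rule filterlim_mono) (auto intro: at_le)
  moreover have "F 1 = real (\<Sum>i=1..N. r i)" by (simp add: F_def)
  then have "F 1 > 1" using N by linarith
  ultimately have "eventually (\<lambda>y. F y > 1) (at_left 1)" by (rule order_tendstoD)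
  moreover have "eventually (\<lambda>y::real. y \<in> {0<..<1}) (at_left 1)"
    by (rule eventually_at_left_real) simp
  ultimately have "eventually (\<lambda>y. F y > 1 \<and> y \<in> {0<..<1}) (at_left 1)" by (rule eventually_conj)
  then obtain y where y: "F y > 1" "0 < y" "y < 1"
    using eventually_happens[of _ "at_left (1::real)"] by (auto simp: trivial_limit_at_left_real)
  have "{..N} = insert 0 {1..N}" by auto
  then have "F y - 1 = (\<Sum>n\<le>N. root_coeff r n * y ^ n)"
    by (simp add: F_def root_coeff_def)
  also have "\<dots> \<le> (\<Sum>n. root_coeff r n * y ^ n)"
    using y by (intro sum_le_suminf summable_root_coeff_real) (auto simp: root_coeff_def)
  finally have "0 < (\<Sum>n. root_coeff r n * y ^ n)" using y by simp
  then have "poly (limit_poly r k) y > 0"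
    using y by (simp add: poly_limit_poly_real)
  moreover have "poly (limit_poly r k) 0 = -1"
    using coeff_limit_poly[of 0] by (simp add: poly_0_coeff_0 root_coeff_def)
  ultimately obtain x where "0 < x" "x < y" "poly (limit_poly r k) x = 0"
    using poly_IVT_pos[of 0 y "limit_poly r k"] y by auto
  then show ?thesis using y by (intro exI[of _ x]) auto
qed

text \<open>Equality case of the triangle inequality: subtracting the vanishing series at
  \<open>x\<close> and at \<open>z\<close> leaves nonnegative terms with sum 0. So
  \<open>z ^ i\<close> has real part \<open>x ^ i\<close>, and no larger modulus, whenever
  \<open>r i\<close> is positive; hence \<open>(z / x) ^ i = 1\<close> for these
  \<open>i\<close>.\<close>

lemma limit_poly_root_unique:
  fixes z :: complex
  assumes x: "0 < x" "x < 1" "poly (limit_poly r k) x = 0"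
    and gcd: "Gcd {i. i \<ge> 1 \<and> r i \<ge> 1} = 1"
    and z: "norm z \<le> x" "poly (map_poly of_real (limit_poly r k)) z = 0"
  shows "z = of_real x"
proof -
  have z1: "norm z < 1" using z x by simp
  have "(\<Sum>n. of_real (root_coeff r n) * z ^ n) = 0"
    using poly_limit_poly_sums[OF z1] z z1 by auto
  moreover have "summable (\<lambda>n. of_real (root_coeff r n) * z ^ n)"
    using summable_root_coeff[OF z1] by (rule summable_norm_cancel)
  ultimately have "(\<lambda>n. of_real (root_coeff r n) * z ^ n) sums 0"
    using summable_sums by metis
  from sums_Re[OF this] have Re0: "(\<lambda>n. root_coeff r n * Re (z ^ n)) sums 0" by simp
  have "(\<Sum>n. root_coeff r n * x ^ n) = 0"
    using poly_limit_poly_real[of x] x by simp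
  then have "(\<lambda>n. root_coeff r n * x ^ n) sums 0"
    using summable_sums[OF summable_root_coeff_real[of x]] x by simp
  from sums_diff[OF this Re0] have s: "(\<lambda>n. root_coeff r n * (x ^ n - Re (z ^ n))) sums 0"
    by (simp add: algebra_simps)
  have le: "norm (z ^ n) \<le> x ^ n" for n using z by (simp add: norm_power power_mono)
  \<comment> \<open>The negative coefficient at index 0 is harmless, as both zeroth powers are
    1.\<close>
  have nonneg: "0 \<le> root_coeff r n * (x ^ n - Re (z ^ n))" for n
    using le[of n] complex_Re_le_cmod[of "z ^ n"] by (simp add: root_coeff_def)
  have zero: "root_coeff r n * (x ^ n - Re (z ^ n)) = 0" for n
    using suminf_eq_zero_iff[OF sums_summable[OF s] nonneg] sums_unique[OF s] by simp
  have Re_eq: "Re (z ^ i) = x ^ i" if "i \<in> {i. i \<ge> 1 \<and> r i \<ge> 1}" for i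
    using that zero[of i] by (auto simp: root_coeff_def)
  have "(z / of_real x) ^ i = 1" if "i \<in> {i. i \<ge> 1 \<and> r i \<ge> 1}" for i
  proof -
    have "cmod (z ^ i) ^ 2 \<le> (x ^ i) ^ 2" using le by (rule power_mono) simp
    then have "Im (z ^ i) = 0" using Re_eq[OF that] by (simp add: cmod_power2)
    then have "z ^ i = of_real x ^ i" using Re_eq[OF that] by (simp add: complex_eq_iff flip: of_real_power)
    then show ?thesis using x by (simp add: power_divide)
  qed
  from eq_1_of_powers_eq_1[OF gcd this] show ?thesis using x by simp
qed

section \<open>Generating function and asymptotics of \<open>zero_len\<close>\<close>

lemma zero_len_fps:
  "Abs_fps (\<lambda>n. of_nat (zero_len s r n)) * fps_of_poly (map_poly of_real (limit_poly r k)) = (- 1 :: complex fps)"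
proof -
  define U :: "complex fps" where "U = Abs_fps (\<lambda>n. of_real (root_coeff r n))"
  let ?C = "Abs_fps (\<lambda>n. of_nat (zero_len s r n)) :: complex fps"
  have p: "fps_of_poly (map_poly of_real (limit_poly r k)) = (1 - fps_X) * U"
    by (rule fps_ext) (auto simp: U_def algebra_simps coeff_map_poly coeff_limit_poly)
  \<comment> \<open>This is the recurrence \<open>zero_len_rec'\<close>; its summand 1 produces the
    geometric series, which the factor \<open>1 - fps_X\<close> removes.\<close>
  have "U * ?C = Abs_fps (\<lambda>_. -1)"
  proof (rule fps_ext)
    fix n :: nat
    have "{0..n} = insert 0 {1..n}" by auto
    then have "(U * ?C) $ n = - of_nat (zero_len s r n) + (\<Sum>i=1..n. of_nat (r i * zero_len s r (n - i)))"
      by (simp add: fps_mult_nth U_def root_coeff_def)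
    also have "\<dots> = -1"
      by (subst zero_len_rec') simp
    finally show "(U * ?C) $ n = Abs_fps (\<lambda>_. -1) $ n" by simp
  qed
  moreover have "(1 - fps_X) * Abs_fps (\<lambda>_. -1) = (-1 :: complex fps)"
    by (rule fps_ext) (auto simp: algebra_simps)
  ultimately show ?thesis unfolding p by (metis mult.commute mult.assoc)
qed

text \<open>Splitting off the root \<open>x\<close> leaves a factor \<open>Q\<close> without zeros
  in the closed disc of radius \<open>x\<close>. So \<open>1/Q\<close> converges at
  \<open>x\<close>, and its partial sums there are exactly the sequence in question.\<close>

lemma zero_len_asymptotics:
  assumes x: "0 < x" "x < 1" "poly (limit_poly r k) x = 0"
    and gcd: "Gcd {i. i \<ge> 1 \<and> r i \<ge> 1} = 1"
  shows "\<exists>c>0. (\<lambda>n. real (zero_len s r n) * x ^ Suc n) \<longlonglongrightarrow> c"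
proof -
  let ?p = "map_poly of_real (limit_poly r k) :: complex poly"
  have "{i. i \<ge> 1 \<and> r i \<ge> 1} \<noteq> {}" using gcd by (metis Gcd_empty zero_neq_one)
  then obtain i where i: "i \<ge> 1" "r i \<ge> 1" by auto
  have of_real_poly: "poly ?p (of_real y) = of_real (poly (limit_poly r k) y)" for y
    by (simp add: poly_altdef degree_map_poly coeff_map_poly)
  have "poly ?p (of_real x) = 0" using x by (simp add: of_real_poly)
  then obtain Q where Q: "?p = [:- of_real x, 1:] * Q"
    by (metis poly_eq_0_iff_dvd dvdE)
  \<comment> \<open>A lower bound independent of \<open>y\<close>; letting \<open>y\<close> tend to
    \<open>x\<close> from the left shows that \<open>x\<close> is a simple root.\<close>
  have "norm (poly Q (of_real y)) \<ge> (1 - x) * x ^ (i - 1)" if y: "0 < y" "y < x" for y :: real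
  proof -
    have "(1 - x) * ((x - y) * x ^ (i - 1)) \<le> (1 - y) * ((\<Sum>n. root_coeff r n * x ^ n) - (\<Sum>n. root_coeff r n * y ^ n))"
      using root_coeff_series_less[of y x i] x y i by (intro mult_mono) auto
    also have "\<dots> = - poly (limit_poly r k) y"
      using poly_limit_poly_real[of x] poly_limit_poly_real[of y] x y by simp
    also have "\<dots> \<le> norm (poly ?p (of_real y))" by (simp add: of_real_poly)
    also have "\<dots> = (x - y) * norm (poly Q (of_real y))"
    proof -
      have "poly ?p (of_real y) = of_real (y - x) * poly Q (of_real y)"
        unfolding Q by (simp add: algebra_simps)
      then show ?thesis using y by (simp only: norm_mult norm_of_real) simp
    qed
    finally have "(x - y) * ((1 - x) * x ^ (i - 1)) \<le> (x - y) * norm (poly Q (of_real y))"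
      by (simp add: mult_ac)
    then show ?thesis using y by simp
  qed
  then have "eventually (\<lambda>y. (1 - x) * x ^ (i - 1) \<le> norm (poly Q (of_real y))) (at_left x)"
    using eventually_at_left_real[OF x(1)] by (auto elim!: eventually_mono)
  moreover have "((\<lambda>y. norm (poly Q (of_real y))) \<longlongrightarrow> norm (poly Q (of_real x))) (at_left x)"
    by (intro tendsto_intros isCont_tendsto_compose[OF poly_isCont])
  ultimately have "(1 - x) * x ^ (i - 1) \<le> norm (poly Q (of_real x))"
    by (intro tendsto_lowerbound[of _ _ "at_left x"]) auto
  moreover have "0 < (1 - x) * x ^ (i - 1)" using x by simp
  ultimately have Qx: "poly Q (of_real x) \<noteq> 0" by auto
  have Q0: "poly Q z \<noteq> 0" if "norm z \<le> x" for z
    using limit_poly_root_unique[OF x gcd that] Qx by (cases "z = of_real x") (auto simp: Q)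
  have "Q \<noteq> 0" using Qx by auto
  then have fin: "finite (insert (x + 1) (norm ` {z. poly Q z = 0}))"
    by (intro finite.insertI finite_imageI poly_roots_finite)
  \<comment> \<open>The least modulus of a zero of \<open>Q\<close>, capped at \<open>x + 1\<close>,
    which also covers a constant \<open>Q\<close>.\<close>
  define R where "R = Min (insert (x + 1) (norm ` {z. poly Q z = 0}))"
  have "R \<in> insert (x + 1) (norm ` {z. poly Q z = 0})" unfolding R_def using fin by (intro Min_in) auto
  then have "x < R" using Q0 by (auto simp: not_le[symmetric])
  have "poly Q z \<noteq> 0" if "norm z < R" for z
  proof
    assume "poly Q z = 0"
    then have "R \<le> norm z" unfolding R_def using fin by (intro Min_le) auto
    with that show False by simp
  qed
  then have ne: "eval_fps (fps_of_poly Q) z \<noteq> 0" if "ereal (norm z) < ereal R" for z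
    using that by simp
  define q where "q = inverse (fps_of_poly Q)"
  have "fps_conv_radius q \<ge> R"
    using fps_conv_radius_inverse[of "ereal R" "fps_of_poly Q", OF ne] by (simp add: q_def)
  then have "ereal (norm (of_real x :: complex)) < fps_conv_radius q"
    using \<open>x < R\<close> x by (auto intro: less_le_trans[of _ "ereal R"])
  then have "(\<lambda>n. fps_nth q n * of_real x ^ n) sums eval_fps q (of_real x)" by (rule sums_eval_fps)
  moreover have "eval_fps q (of_real x) = inverse (poly Q (of_real x))"
    using eval_fps_inverse[of "ereal R" "fps_of_poly Q" "of_real x", OF ne] x \<open>x < R\<close>
    by (simp add: q_def)
  ultimately have lim: "(\<lambda>n. \<Sum>i\<le>n. fps_nth q i * of_real x ^ i) \<longlonglongrightarrow> inverse (poly Q (of_real x))"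
    by (simp add: sums_def_le)
  let ?C = "Abs_fps (\<lambda>n. of_nat (zero_len s r n)) :: complex fps"
  have "fps_of_poly Q $ 0 \<noteq> 0" using Q0[of 0] x by (simp add: poly_0_coeff_0)
  then have Qq: "fps_of_poly Q * q = 1" unfolding q_def by (simp add: inverse_mult_eq_1')
  have CQ: "?C * (fps_of_poly [:- of_real x, 1:] * fps_of_poly Q) = -1"
    using zero_len_fps[of s] unfolding Q fps_of_poly_mult .
  have "?C * fps_of_poly [:- of_real x, 1:] * (fps_of_poly Q * q)
      = ?C * (fps_of_poly [:- of_real x, 1:] * fps_of_poly Q) * q"
    by (simp only: mult.assoc)
  then have "?C * fps_of_poly [:- of_real x, 1:] = - q"
    unfolding CQ Qq by simp
  moreover have "fps_of_poly [:- of_real x, 1:] = fps_X - fps_const (of_real x :: complex)"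
    by (rule fps_ext) (auto simp: coeff_pCons fps_X_def split: nat.split)
  ultimately have "?C * (fps_X - fps_const (of_real x)) = - q" by simp
  then have q: "q = fps_const (of_real x) * ?C - fps_X * ?C"
    by (simp add: algebra_simps equation_minus_iff)
  \<comment> \<open>Coefficient \<open>i\<close> of \<open>q\<close> is \<open>x\<close> times
    \<open>zero_len\<close> at \<open>i\<close> minus \<open>zero_len\<close> at
    \<open>i - 1\<close>, so the sum telescopes; this explains the exponent
    \<open>Suc n\<close>.\<close>
  have "(\<Sum>i\<le>n. fps_nth q i * of_real x ^ i) = of_real (real (zero_len s r n) * x ^ Suc n)" for n
    by (induction n) (simp_all add: q algebra_simps)
  with lim have "(\<lambda>n. of_real (real (zero_len s r n) * x ^ Suc n)) \<longlonglongrightarrow> inverse (poly Q (of_real x))"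
    by simp
  from tendsto_norm[OF this] have "(\<lambda>n. real (zero_len s r n) * x ^ Suc n) \<longlonglongrightarrow> norm (inverse (poly Q (of_real x)))"
    using x by (simp add: norm_mult norm_power)
  then show ?thesis using Qx by (intro exI[of _ "norm (inverse (poly Q (of_real x)))"]) auto
qed

end

subsection \<open>The limit\<close>

lemma a_R_tendsto_root:
  fixes s k :: nat and r :: "nat \<Rightarrow> nat"
  assumes s: "s \<ge> 1" and const: "\<And>i. i \<ge> k + 1 \<Longrightarrow> r i = r (k + 1)"
    and x: "0 < x" "x < 1" "poly (limit_poly r k) x = 0"
    and gcd: "Gcd {i. i \<ge> 1 \<and> r i \<ge> 1} = 1"
  shows "(\<lambda>n. real (a_R s r (int n)) / real n) \<longlonglongrightarrow> x"
proof -
  have "{i. i \<ge> 1 \<and> r i \<ge> 1} \<noteq> {}" using gcd by (metis Gcd_empty zero_neq_one)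
  then obtain i where i: "i \<ge> 1" "r i \<ge> 1" by auto
  obtain B where B: "\<And>i. i \<ge> 1 \<Longrightarrow> real (r i) \<le> B"
    using bounded_of_eventually_const[of k r] const by blast
  show ?thesis
  proof (rule a_R_tendsto_of_zero_len[OF s, where B = "max (real s) B"])
    show "filterlim (\<lambda>n. real (zero_len s r n)) at_top sequentially"
      using i by (rule zero_len_at_top)
    show "real (r j) \<le> max (real s) B" if "j \<ge> 1" for j
      using B[OF that] by simp
    fix \<epsilon> :: real assume "\<epsilon> > 0"
    define v where "v n = real (zero_len s r n) * x ^ Suc n" for n
    obtain c where c: "c > 0" "v \<longlonglongrightarrow> c"
      using zero_len_asymptotics[of k r x s] const x gcd unfolding v_def by blast
    \<comment> \<open>Scaled by \<open>x ^ Suc n\<close>, the deviation to be bounded is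
      \<open>v n - v (Suc n)\<close>. It tends to 0, while \<epsilon> times \<open>v n\<close> has a
      positive limit.\<close>
    have "(\<lambda>n. \<epsilon> * v n - \<bar>v n - v (Suc n)\<bar>) \<longlonglongrightarrow> \<epsilon> * c - \<bar>c - c\<bar>"
      by (intro tendsto_intros c LIMSEQ_Suc)
    moreover have "0 < \<epsilon> * c - \<bar>c - c\<bar>" using \<open>\<epsilon> > 0\<close> c by simp
    ultimately have "eventually (\<lambda>n. 0 < \<epsilon> * v n - \<bar>v n - v (Suc n)\<bar>) sequentially"
      by (rule order_tendstoD)
    then show "eventually (\<lambda>n. \<bar>real (zero_len s r n) - x * real (zero_len s r (Suc n))\<bar>
        \<le> \<epsilon> * real (zero_len s r n)) sequentially"
    proof eventually_elim
      case (elim n)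
      have "v n - v (Suc n) = (real (zero_len s r n) - x * real (zero_len s r (Suc n))) * x ^ Suc n"
        by (simp add: v_def algebra_simps)
      then have "\<bar>v n - v (Suc n)\<bar> = \<bar>real (zero_len s r n) - x * real (zero_len s r (Suc n))\<bar> * x ^ Suc n"
        using x by (simp only: abs_mult) simp
      with elim have "\<bar>real (zero_len s r n) - x * real (zero_len s r (Suc n))\<bar> * x ^ Suc n
          \<le> (\<epsilon> * real (zero_len s r n)) * x ^ Suc n"
        by (simp add: v_def mult_ac)
      then show ?case using x by (metis mult_le_cancel_right_pos zero_less_power)
    qed
  qed (use x in auto)
qed

text \<open>Treats the sums 0 and 1 together. Below 1 the series is at most
  \<open>-1 + y ^ i\<close>, which is negative.\<close>

lemma smallest_positive_root_1:
  fixes r :: "nat \<Rightarrow> nat" and k :: nat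
  assumes const: "\<And>i. i \<ge> k + 1 \<Longrightarrow> r i = r (k + 1)"
    and r: "\<And>j. j \<ge> 1 \<Longrightarrow> j \<noteq> i \<Longrightarrow> r j = 0" and i: "i \<ge> 1" "r i \<le> 1"
  shows "smallest_positive_root (limit_poly r k) 1"
  unfolding smallest_positive_root_def
proof (intro conjI allI impI)
  \<comment> \<open>A nonzero constant tail would have more than one nonzero entry.\<close>
  have "r (k + 1) = 0"
  proof (cases "k + 1 = i")
    case True
    then show ?thesis using r[of "k + 2"] const[of "k + 2"] by simp
  next
    case False
    then show ?thesis using r[of "k + 1"] by simp
  qed
  then show "poly (limit_poly r k) 1 = 0" by (simp add: limit_poly_def)
  fix y :: real assume y: "y > 0 \<and> poly (limit_poly r k) y = 0"
  show "1 \<le> y"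
  proof (rule ccontr)
    assume "\<not> 1 \<le> y"
    then have "y < 1" by simp
    have "(\<lambda>n. root_coeff r n * y ^ n) sums (\<Sum>n\<in>{0, i}. root_coeff r n * y ^ n)"
      using r by (intro sums_finite) (auto simp: root_coeff_def)
    then have "(\<Sum>n. root_coeff r n * y ^ n) = -1 + real (r i) * y ^ i"
      using i by (simp add: sums_iff root_coeff_def)
    moreover have "real (r i) * y ^ i \<le> 1 * y ^ i"
      using i y by (intro mult_right_mono) auto
    moreover have "y ^ i < 1" using y \<open>y < 1\<close> i by (simp add: power_less_one_iff)
    ultimately have "(\<Sum>n. root_coeff r n * y ^ n) < 0" by linarith
    moreover have "poly (limit_poly r k) y = (1 - y) * (\<Sum>n. root_coeff r n * y ^ n)"
      by (rule poly_limit_poly_real) (fact const, use y \<open>y < 1\<close> in auto)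
    then have "(1 - y) * (\<Sum>n. root_coeff r n * y ^ n) = 0" using y by simp
    ultimately show False using \<open>y < 1\<close> by simp
  qed
qed simp

text \<open>The infinite sum may diverge, so the third case is expressed by a partial sum.\<close>

lemma sum_trichotomy:
  fixes r :: "nat \<Rightarrow> nat"
  obtains (zero) "\<And>i. i \<ge> 1 \<Longrightarrow> r i = 0"
  | (one) i where "i \<ge> 1" "r i = 1" "\<And>j. j \<ge> 1 \<Longrightarrow> j \<noteq> i \<Longrightarrow> r j = 0"
  | (large) N where "(\<Sum>i=1..N. r i) \<ge> 2"
proof (cases "\<forall>i\<ge>1. r i = 0")
  case True
  then show ?thesis using zero by blast
next
  case False
  then obtain i where i: "i \<ge> 1" "r i \<noteq> 0" by blast
  show ?thesis
  proof (cases "r i = 1 \<and> (\<forall>j\<ge>1. j \<noteq> i \<longrightarrow> r j = 0)")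
    case True
    then show ?thesis using i one by blast
  next
    case False
    show ?thesis
    proof (cases "r i = 1")
      case True
      with False obtain j where j: "j \<ge> 1" "j \<noteq> i" "r j \<noteq> 0" by blast
      have "(\<Sum>l\<in>{i, j}. r l) \<le> (\<Sum>l=1..i+j. r l)"
        using i j by (intro sum_mono2) auto
      with i j have "2 \<le> (\<Sum>l=1..i+j. r l)" by simp
      then show ?thesis by (rule large)
    next
      case False
      have "r i \<le> (\<Sum>l=1..i. r l)"
        using i by (intro member_le_sum) auto
      with False i have "2 \<le> (\<Sum>l=1..i. r l)" by linarith
      then show ?thesis by (rule large)
    qed
  qed
qed

lemma sums_ge_partial_sum:
  fixes r :: "nat \<Rightarrow> nat"
  assumes "(\<lambda>i. real (r (Suc i))) sums t"
  shows "real (\<Sum>i=1..N. r i) \<le> t"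
proof -
  have "real (\<Sum>i=1..N. r i) = (\<Sum>i<N. real (r (Suc i)))"
    by (simp add: sum.atLeast1_atMost_eq)
  also have "\<dots> \<le> (\<Sum>i. real (r (Suc i)))"
    using assms by (intro sum_le_suminf) (auto simp: sums_iff)
  finally show ?thesis using assms by (simp add: sums_iff)
qed

theorem theorem11:
  fixes s k :: nat and r :: "nat \<Rightarrow> nat"
  assumes "s \<ge> 1" and "k \<ge> 1"
    and "\<And>i. i \<ge> k + 1 \<Longrightarrow> r i = r (k + 1)"
  shows "((\<exists>L. (\<lambda>n::nat. real (a_R s r (int n)) / real n) \<longlonglongrightarrow> L) \<longleftrightarrow>
            ((\<lambda>i. real (r (Suc i))) sums 0 \<or> (\<lambda>i. real (r (Suc i))) sums 1) \<or>
            Gcd {i. i \<ge> 1 \<and> r i \<ge> 1} = 1) \<and>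
         (\<forall>L. (\<lambda>n::nat. real (a_R s r (int n)) / real n) \<longlonglongrightarrow> L \<longrightarrow>
            smallest_positive_root (limit_poly r k) L)"
proof -
  let ?lim = "\<lambda>L. (\<lambda>n::nat. real (a_R s r (int n)) / real n) \<longlonglongrightarrow> L"
  let ?small = "(\<lambda>i. real (r (Suc i))) sums 0 \<or> (\<lambda>i. real (r (Suc i))) sums 1"
  let ?gcd = "Gcd {i. i \<ge> 1 \<and> r i \<ge> 1} = 1"
  note const = assms(3)
  \<comment> \<open>By uniqueness of limits, a single limit that is the smallest positive root
    settles both halves of the claim.\<close>
  have conclude: ?thesis if "?small \<or> ?gcd" "?lim L" "smallest_positive_root (limit_poly r k) L" for L
  proof (intro conjI allI impI iffI)
    show "smallest_positive_root (limit_poly r k) L'" if "?lim L'" for L'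
      using LIMSEQ_unique[OF \<open>?lim L\<close> that] \<open>smallest_positive_root (limit_poly r k) L\<close> by simp
  qed (use that in blast)+
  show ?thesis
  proof (cases rule: sum_trichotomy[of r])
    case zero
    then have "(\<lambda>i. real (r (Suc i))) sums 0" by simp
    moreover have "smallest_positive_root (limit_poly r k) 1"
    proof (rule smallest_positive_root_1[of k r 1])
      show "r j = r (k + 1)" if "j \<ge> k + 1" for j using that by (rule const)
      show "r 1 \<le> 1" using zero[of 1] by simp
    qed (use zero in auto)
    ultimately show ?thesis
      using a_R_tendsto_sum_0[OF assms(1) zero] by (intro conclude) blast+
  next
    case (one i)
    have "(\<lambda>j. real (r (Suc j))) sums (\<Sum>j\<in>{i - 1}. real (r (Suc j)))"
      using one by (intro sums_finite) auto
    then have "(\<lambda>j. real (r (Suc j))) sums 1" using one by simp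
    moreover have "smallest_positive_root (limit_poly r k) 1"
    proof (rule smallest_positive_root_1[of k r i])
      show "r j = r (k + 1)" if "j \<ge> k + 1" for j using that by (rule const)
      show "r i \<le> 1" using one(2) by simp
    qed (use one in blast)+
    moreover have "?lim 1"
      by (rule a_R_tendsto_sum_1[of s i r]) (fact assms one)+
    ultimately show ?thesis by (intro conclude) blast+
  next
    case (large N)
    have not_small: "\<not> ?small"
    proof
      have False if "(\<lambda>i. real (r (Suc i))) sums t" "t \<le> 1" for t
        using sums_ge_partial_sum[OF that(1), of N] that(2) large by linarith
      moreover assume ?small
      ultimately show False by (metis order_refl zero_le_one)
    qed
    show ?thesis
    proof (cases ?gcd)
      case True
      then have "{i. i \<ge> 1 \<and> r i \<ge> 1} \<noteq> {}" by (metis Gcd_empty zero_neq_one)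
      then obtain i where i: "i \<ge> 1" "r i \<ge> 1" by auto
      obtain x where x: "0 < x" "x < 1" "poly (limit_poly r k) x = 0"
        using limit_poly_root_exists[OF _ large, of k] const by blast
      show ?thesis
      proof (rule conclude)
        show "?lim x"
          by (rule a_R_tendsto_root[of s k r x]) (fact assms const x True)+
        show "smallest_positive_root (limit_poly r k) x"
          by (rule smallest_positive_root_limit_poly[of k r x i]) (fact const x i)+
      qed (use True in blast)
    next
      case False
      have "\<not> ?lim L" for L
        by (rule a_R_not_convergent[OF assms(1) large False])
      with False not_small show ?thesis by blast
    qed
  qed
qed

end
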